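(* Let $k+l=n+1$ and let $(M^4,g)$ be a self-dual Einstein metric with two commuting Killing vector fields obtained as a semi-quaternion Kähler quotient of $\mathbb H\mathcal H^{k-1,l}$ or $\mathbb H\mathcal H^{k,l-1}$ by an $(n-1)$-dimensional Abelian subgroup $G$ of $Sp(k,l)$. Let $\tilde F$ be the homogeneity $1/2$ lift of the hyperbolic eigenfunction $F$ generating $g$, locally, with respect to a $2$-dimensional Abelian quotient group $H/G$ acting by isometries. Then the pullback of $\tilde F$ to the zero set of the momentum map of $G$ in $\mathbb H^{k,l}$ is a nonzero constant multiple of the restriction of the quadratic form $F_{k,l}(\mathbf u,\mathbf u)$.
   Context: Quadratic form and quotients. $\mathbb H^{k,l}$ is $\mathbb H^{n+1}$ (right $\mathbb H$-module, $\mathbf u=(u_0,\dots,u_n)$) with the quadratic form $F_{k,l}(\mathbf u,\mathbf u)=-\sum_{\alpha=0}^{k-1}|u_\alpha|^2+\sum_{\alpha=k}^{n}|u_\alpha|^2$. Let $\mathbb F_{k,l}$ be the corresponding diagonal matrix; $Sp(k,l)$ is the group of quaternionic matrices preserving the form, and $\mathfrak{sp}(k,l)$ is its Lie algebra. $\mathbb H\mathcal H^{k-1,l}$ and $\mathbb H\mathcal H^{k,l-1}$ are the spaces of right quaternionic lines on which the form is negative, respectively positive, with their natural semi-quaternion Kähler metrics. For $Y\in\mathfrak{sp}(k,l)$ the momentum map is $\mu_Y(\mathbf u)=\mathbf u^\dagger\mathbb F_{k,l}Y\mathbf u\in\mathrm{Im}\,\mathbb H$. The zero set of the momentum map of $G$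 is $N=\{\mathbf u: \mu_Y(\mathbf u)=0\ \forall\,Y\in\mathfrak g\}$, $\mathfrak g=\mathrm{Lie}(G)$, considered on non-null vectors. The quotient $M$ is (an open part of, where it is a manifold with definite metric) the quotient by $G$ of the image of $N$ in the space of lines. Its metric is obtained by restriction and submersion. All statements are local, on connected open sets where the two Killing fields are linearly independent. Quotient torus and map to the hyperbolic plane. $H$ is a maximal Abelian subgroup of $Sp(k,l)$ containing $G$, of dimension $n+1$; the $2$-dimensional group $H/G$ acts on $M$ by isometries. Choose $X_1,X_2\in\mathrm{Lie}(H)$ projecting to a basis of $\mathrm{Lie}(H)/\mathfrak g\cong\mathbb R^2$. On $N$ put $x_i=\mu_{X_i}(\mathbf u)\in\mathrm{Im}\,\mathbb H$ (depending only on $X_i$ modulo $\mathfrak g$), and consider the open set where $x_1,x_2$ are linearly independent. The Gram matrix $A(\mathbf u)=(\langle x_i,x_j\rangle)_{i,j=1,2}$ is a positive definite element of $S^2\mathbb R^2$. Let $\mathcal H^2$ be the hyperboloid of positive definite symmetric $2\times2$ matrices of determinant one, with the hyperbolic metric, and half-space coordinates $(\rho,\eta)$, $\rho>0$, given by $$\begin{pmatrix}1/\rho&\eta/\rho\\ \eta/\rho&(\rho^2+\eta^2)/\rho\end{pmatrix}.$$ The map $\mathbf u\mapsto A(\mathbf u)/\sqrt{\det A(\mathbf u)}\in\mathcal H^2$ descends to a map $M\to\mathcal H^2$ invariant under $H/G$. Generating eigenfunction. A hyperbolic eigenfunction is a function $F$ on an open subset of $\mathcal H^2$ with $F_{\rho\rho}+F_{\eta\eta}=\frac{3}{4\rho^2}F$.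 By a theorem of Calderbank and Pedersen, $g$ is locally, up to a nonzero constant multiple, of the form $$g_F=\frac{F^2-4\rho^2(F_\rho^2+F_\eta^2)}{4F^2}\,\frac{d\rho^2+d\eta^2}{\rho^2}+\frac{\bigl((F-2\rho F_\rho)\alpha-2\rho F_\eta\beta\bigr)^2+\bigl(-2\rho F_\eta\alpha+(F+2\rho F_\rho)\beta\bigr)^2}{F^2\bigl(F^2-4\rho^2(F_\rho^2+F_\eta^2)\bigr)},$$ $$\alpha=\sqrt\rho\,d\varphi,\qquad \beta=\frac{d\psi+\eta\,d\varphi}{\sqrt\rho}.$$ Here $(\rho,\eta)$ are pulled back by the map $M\to\mathcal H^2$ above, and $\partial_\varphi,\partial_\psi$ span the infinitesimal action of $H/G$. This $F$ is the eigenfunction generating $g$ with respect to $H/G$. Lift and pullback. The homogeneity $1/2$ lift is $\tilde F(A)=(\det A)^{1/4}F\bigl(A/\sqrt{\det A}\bigr)$ on positive definite $A\in S^2\mathbb R^2$ (over the domain of $F$). The pullback of $\tilde F$ to $N$ is $\mathbf u\mapsto\tilde F(A(\mathbf u))$. *)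

theory Defs
  imports "HOL-Analysis.Analysis" "HOL-Algebra.Group"
begin

section \<open>Quaternions\<close>

datatype quat = Quat (re: real) (im1: real) (im2: real) (im3: real)

lemma quat_eq_iff: "p = q \<longleftrightarrow> re p = re q \<and> im1 p = im1 q \<and> im2 p = im2 q \<and> im3 p = im3 q"
  by (cases p; cases q) simp

instantiation quat :: ring_1
begin

definition "0 = Quat 0 0 0 0"
definition "1 = Quat 1 0 0 0"
definition "p + q = Quat (re p + re q) (im1 p + im1 q) (im2 p + im2 q) (im3 p + im3 q)"
definition "- q = Quat (- re q) (- im1 q) (- im2 q) (- im3 q)"
definition "p - q = Quat (re p - re q) (im1 p - im1 q) (im2 p - im2 q) (im3 p - im3 q)"
definition "p * q = Quat
  (re p * re q - im1 p * im1 q - im2 p * im2 q - im3 p * im3 q)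
  (re p * im1 q + im1 p * re q + im2 p * im3 q - im3 p * im2 q)
  (re p * im2 q - im1 p * im3 q + im2 p * re q + im3 p * im1 q)
  (re p * im3 q + im1 p * im2 q - im2 p * im1 q + im3 p * re q)"

instance
  by standard
    (simp_all add: zero_quat_def one_quat_def plus_quat_def uminus_quat_def minus_quat_def
      times_quat_def algebra_simps)

end

instantiation quat :: real_algebra_1
begin

definition "a *\<^sub>R q = Quat (a * re q) (a * im1 q) (a * im2 q) (a * im3 q)"

instance
  by standard
    (simp_all add: one_quat_def plus_quat_def times_quat_def scaleR_quat_def algebra_simps)

end

instantiation quat :: real_inner
begin

definition "p \<bullet> q = re p * re q + im1 p * im1 q + im2 p * im2 q + im3 p * im3 q"
definition "norm (q::quat) = sqrt (q \<bullet> q)"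
definition "dist p q = norm (p - q :: quat)"
definition "sgn q = inverse (norm q) *\<^sub>R (q::quat)"
definition "uniformity = (INF e\<in>{0<..}. principal {(p, q). dist p q < (e::real)} :: (quat \<times> quat) filter)"
definition "open (U :: quat set) \<longleftrightarrow> (\<forall>p\<in>U. \<forall>\<^sub>F (p', q) in uniformity. p' = p \<longrightarrow> q \<in> U)"

instance
proof
  fix p q r :: quat and a :: real
  show "p \<bullet> q = q \<bullet> p" "(p + q) \<bullet> r = p \<bullet> r + q \<bullet> r" "(a *\<^sub>R p) \<bullet> q = a * (p \<bullet> q)"
    by (simp_all add: inner_quat_def plus_quat_def scaleR_quat_def algebra_simps)
  show "0 \<le> p \<bullet> p"
    by (simp add: inner_quat_def)
  have "a\<^sup>2 + b\<^sup>2 + c\<^sup>2 + d\<^sup>2 = 0 \<longleftrightarrow> a = 0 \<and> b = 0 \<and> c = 0 \<and> d = 0" for a b c d :: real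
    by (metis add_nonneg_eq_0_iff add_nonneg_nonneg zero_eq_power2 zero_le_power2)
  then show "p \<bullet> p = 0 \<longleftrightarrow> p = 0"
    by (simp add: inner_quat_def zero_quat_def quat_eq_iff flip: power2_eq_square)
qed (fact norm_quat_def dist_quat_def sgn_quat_def uniformity_quat_def open_quat_def)+

end

instantiation quat :: euclidean_space
begin

definition "Basis = {Quat 1 0 0 0, Quat 0 1 0 0, Quat 0 0 1 0, Quat 0 0 0 1}"

instance
proof
  fix p :: quat
  show "(\<forall>q\<in>Basis. p \<bullet> q = 0) \<longleftrightarrow> p = 0"
    by (cases p) (simp add: Basis_quat_def inner_quat_def zero_quat_def)
qed (auto simp: Basis_quat_def inner_quat_def)

end

instance quat :: real_normed_algebra_1
proof
  fix p q :: quat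
  have "(p * q) \<bullet> (p * q) = (p \<bullet> p) * (q \<bullet> q)"
    unfolding inner_quat_def times_quat_def quat.sel by algebra
  then show "norm (p * q) \<le> norm p * norm q"
    by (simp add: norm_quat_def real_sqrt_mult)
  show "norm (1::quat) = 1"
    by (simp add: norm_quat_def inner_quat_def one_quat_def)
qed

definition qcnj :: "quat \<Rightarrow> quat" where
  "qcnj q = Quat (re q) (- im1 q) (- im2 q) (- im3 q)"


section \<open>The indefinite quaternionic form and its symmetry group\<close>

text \<open>
  The right module of quaternionic vectors with \<open>n + 1\<close> entries is rendered as \<open>quat ^ 'm\<close>, where an enumeration
  \<open>e :: 'm \<Rightarrow> nat\<close> (a bijection onto \<open>{..n}\<close> in the theorem) supplies the numbering
  \<open>u\<^sub>0, \<dots>, u\<^sub>n\<close> of the coordinates. Matrices act on the left, scalars on the right.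
\<close>

definition rscale :: "quat ^ 'm \<Rightarrow> quat \<Rightarrow> quat ^ 'm" where
  "rscale u q = (\<chi> i. u $ i * q)"

definition eps :: "('m \<Rightarrow> nat) \<Rightarrow> nat \<Rightarrow> 'm \<Rightarrow> real" where
  "eps e k i = (if e i < k then - 1 else 1)"

text \<open>The quaternionic sesquilinear form \<open>u\<^sup>\<dagger> \<F> v\<close> and its real part, the symmetric
  real bilinear form belonging to the quadratic form.\<close>

definition hform :: "('m::finite \<Rightarrow> nat) \<Rightarrow> nat \<Rightarrow> quat ^ 'm \<Rightarrow> quat ^ 'm \<Rightarrow> quat" where
  "hform e k u v = (\<Sum>i\<in>UNIV. eps e k i *\<^sub>R (qcnj (u $ i) * v $ i))"

definition Fkl :: "('m::finite \<Rightarrow> nat) \<Rightarrow> nat \<Rightarrow> quat ^ 'm \<Rightarrow> quat ^ 'm \<Rightarrow> real" where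
  "Fkl e k u v = (\<Sum>i\<in>UNIV. eps e k i * (u $ i \<bullet> v $ i))"

definition Sp :: "('m::finite \<Rightarrow> nat) \<Rightarrow> nat \<Rightarrow> (quat ^ 'm ^ 'm) monoid" where
  "Sp e k = \<lparr>carrier = {A. invertible A \<and> (\<forall>u. Fkl e k (A *v u) (A *v u) = Fkl e k u u)},
             mult = (**), one = mat 1\<rparr>"

definition abelian_subgroup :: "'a set \<Rightarrow> 'a monoid \<Rightarrow> bool" where
  "abelian_subgroup G S \<longleftrightarrow> subgroup G S \<and> comm_group (S\<lparr>carrier := G\<rparr>)"

definition maximal_abelian_subgroup :: "'a set \<Rightarrow> 'a monoid \<Rightarrow> bool" where
  "maximal_abelian_subgroup H S \<longleftrightarrow> abelian_subgroup H S \<and>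
     (\<forall>H'. abelian_subgroup H' S \<and> H \<subseteq> H' \<longrightarrow> H' = H)"

text \<open>The Lie algebra of a group of matrices: the generators of its one-parameter subgroups
  (equivalently, the \<open>Y\<close> with \<open>exp (t Y) \<in> G\<close> for all \<open>t\<close>). This does not need \<open>G\<close> to be closed.
  The dimension of \<open>G\<close> is the real dimension of \<open>lie G\<close>.\<close>

definition lie :: "(quat ^ 'm::finite ^ 'm) set \<Rightarrow> (quat ^ 'm ^ 'm) set" where
  "lie G = {Y. \<exists>\<gamma> :: real \<Rightarrow> quat ^ 'm ^ 'm. \<gamma> 0 = mat 1 \<and> (\<forall>s t. \<gamma> (s + t) = \<gamma> s ** \<gamma> t) \<and>
      (\<forall>t. \<gamma> t \<in> G) \<and> (\<gamma> has_vector_derivative Y) (at 0)}"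

definition projects_to_basis :: "'a::real_vector \<Rightarrow> 'a \<Rightarrow> 'a set \<Rightarrow> 'a set \<Rightarrow> bool" where
  "projects_to_basis X1 X2 \<gg> \<hh> \<longleftrightarrow> X1 \<in> \<hh> \<and> X2 \<in> \<hh> \<and>
     (\<forall>a b. a *\<^sub>R X1 + b *\<^sub>R X2 \<in> \<gg> \<longrightarrow> a = 0 \<and> b = 0) \<and>
     (\<forall>Z\<in>\<hh>. \<exists>a b. Z - (a *\<^sub>R X1 + b *\<^sub>R X2) \<in> \<gg>)"


section \<open>The momentum map\<close>

text \<open>For \<open>Y\<close> in the Lie algebra of \<^const>\<open>Sp\<close> the value is an imaginary quaternion.\<close>

definition momentum :: "('m::finite \<Rightarrow> nat) \<Rightarrow> nat \<Rightarrow> quat ^ 'm ^ 'm \<Rightarrow> quat ^ 'm \<Rightarrow> quat" where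
  "momentum e k Y u = hform e k u (Y *v u)"

definition zero_set ::
  "('m::finite \<Rightarrow> nat) \<Rightarrow> nat \<Rightarrow> (quat ^ 'm ^ 'm) set \<Rightarrow> (quat ^ 'm) set" where
  "zero_set e k G = {u. \<forall>Y\<in>lie G. momentum e k Y u = 0}"

definition gram ::
  "('m::finite \<Rightarrow> nat) \<Rightarrow> nat \<Rightarrow> quat ^ 'm ^ 'm \<Rightarrow> quat ^ 'm ^ 'm \<Rightarrow> quat ^ 'm \<Rightarrow> real ^ 2 ^ 2" where
  "gram e k X1 X2 u = (let x1 = momentum e k X1 u; x2 = momentum e k X2 u in
     vector [vector [x1 \<bullet> x1, x1 \<bullet> x2], vector [x2 \<bullet> x1, x2 \<bullet> x2]])"

definition lin_indep2 :: "'a::real_vector \<Rightarrow> 'a \<Rightarrow> bool" where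
  "lin_indep2 v w \<longleftrightarrow> (\<forall>a b. a *\<^sub>R v + b *\<^sub>R w = 0 \<longrightarrow> a = 0 \<and> b = 0)"


section \<open>Smooth maps\<close>

primrec Ck_on :: "nat \<Rightarrow> 'a set \<Rightarrow> ('a::real_normed_vector \<Rightarrow> 'b::real_normed_vector) \<Rightarrow> bool" where
  "Ck_on 0 U f \<longleftrightarrow> continuous_on U f"
| "Ck_on (Suc r) U f \<longleftrightarrow>
     (\<exists>f'. (\<forall>x\<in>U. (f has_derivative f' x) (at x)) \<and> (\<forall>v. Ck_on r U (\<lambda>x. f' x v)))"

definition smooth_on :: "'a set \<Rightarrow> ('a::real_normed_vector \<Rightarrow> 'b::real_normed_vector) \<Rightarrow> bool" where
  "smooth_on U f \<longleftrightarrow> (\<forall>r. Ck_on r U f)"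

definition locally_extends_smoothly ::
  "'a set \<Rightarrow> ('a::real_normed_vector \<Rightarrow> 'b::real_normed_vector) \<Rightarrow> bool" where
  "locally_extends_smoothly P f \<longleftrightarrow>
     (\<forall>u\<in>P. \<exists>U f'. open U \<and> u \<in> U \<and> smooth_on U f' \<and> (\<forall>v\<in>U \<inter> P. f' v = f v))"


section \<open>Metrics in a four-dimensional chart\<close>

text \<open>A metric on \<open>M \<subseteq> \<real>\<^sup>4\<close> is a field of symmetric matrices, in the coordinate frame.\<close>

type_synonym metric4 = "real ^ 4 \<Rightarrow> real ^ 4 ^ 4"

definition pd :: "4 \<Rightarrow> (real ^ 4 \<Rightarrow> real) \<Rightarrow> real ^ 4 \<Rightarrow> real" where
  "pd i f x = frechet_derivative f (at x) (axis i 1)"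

definition definite_metric :: "(real ^ 4) set \<Rightarrow> metric4 \<Rightarrow> bool" where
  "definite_metric M g \<longleftrightarrow> smooth_on M g \<and> (\<forall>x\<in>M. transpose (g x) = g x) \<and>
     ((\<forall>x\<in>M. \<forall>\<xi>. \<xi> \<noteq> 0 \<longrightarrow> 0 < \<xi> \<bullet> (g x *v \<xi>)) \<or>
      (\<forall>x\<in>M. \<forall>\<xi>. \<xi> \<noteq> 0 \<longrightarrow> \<xi> \<bullet> (g x *v \<xi>) < 0))"

text \<open>\<open>christoffel g m i j x = \<Gamma>\<^sup>m\<^sub>i\<^sub>j\<close>, and \<open>R(\<partial>\<^sub>i, \<partial>\<^sub>j) \<partial>\<^sub>m = (\<Sum>l. curv g l m i j x \<partial>\<^sub>l)\<close>.\<close>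

definition christoffel :: "metric4 \<Rightarrow> 4 \<Rightarrow> 4 \<Rightarrow> 4 \<Rightarrow> real ^ 4 \<Rightarrow> real" where
  "christoffel g m i j x = (\<Sum>l\<in>UNIV. matrix_inv (g x) $ m $ l *
     (pd i (\<lambda>y. g y $ j $ l) x + pd j (\<lambda>y. g y $ i $ l) x - pd l (\<lambda>y. g y $ i $ j) x)) / 2"

definition curv :: "metric4 \<Rightarrow> 4 \<Rightarrow> 4 \<Rightarrow> 4 \<Rightarrow> 4 \<Rightarrow> real ^ 4 \<Rightarrow> real" where
  "curv g l m i j x = pd i (christoffel g l j m) x - pd j (christoffel g l i m) x +
     (\<Sum>a\<in>UNIV. christoffel g l i a x * christoffel g a j m x
               - christoffel g l j a x * christoffel g a i m x)"

definition lcurv :: "metric4 \<Rightarrow> 4 \<Rightarrow> 4 \<Rightarrow> 4 \<Rightarrow> 4 \<Rightarrow> real ^ 4 \<Rightarrow> real" where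
  "lcurv g l m i j x = (\<Sum>a\<in>UNIV. g x $ l $ a * curv g a m i j x)"

definition ricci :: "metric4 \<Rightarrow> 4 \<Rightarrow> 4 \<Rightarrow> real ^ 4 \<Rightarrow> real" where
  "ricci g m j x = (\<Sum>i\<in>UNIV. curv g i m i j x)"

definition scal :: "metric4 \<Rightarrow> real ^ 4 \<Rightarrow> real" where
  "scal g x = (\<Sum>m\<in>UNIV. \<Sum>j\<in>UNIV. matrix_inv (g x) $ m $ j * ricci g m j x)"

definition weyl :: "metric4 \<Rightarrow> 4 \<Rightarrow> 4 \<Rightarrow> 4 \<Rightarrow> 4 \<Rightarrow> real ^ 4 \<Rightarrow> real" where
  "weyl g l m i j x = lcurv g l m i j x
     - (g x $ l $ i * ricci g m j x - g x $ l $ j * ricci g m i x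
        + g x $ m $ j * ricci g l i x - g x $ m $ i * ricci g l j x) / 2
     + scal g x / 6 * (g x $ l $ i * g x $ m $ j - g x $ l $ j * g x $ m $ i)"

definition einstein :: "(real ^ 4) set \<Rightarrow> metric4 \<Rightarrow> bool" where
  "einstein M g \<longleftrightarrow> (\<exists>\<Lambda>. \<forall>x\<in>M. \<forall>i j. ricci g i j x = \<Lambda> * g x $ i $ j)"

definition levi_civita_symbol :: "4 \<Rightarrow> 4 \<Rightarrow> 4 \<Rightarrow> 4 \<Rightarrow> real" where
  "levi_civita_symbol i j p q =
     det (vector [axis i 1, axis j 1, axis p 1, axis q 1] :: real ^ 4 ^ 4)"

text \<open>\<open>*W = W\<close> for one of the two orientations \<open>or\<close> of the (connected) chart domain.\<close>

definition self_dual :: "(real ^ 4) set \<Rightarrow> metric4 \<Rightarrow> bool" where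
  "self_dual M g \<longleftrightarrow> (\<exists>or\<in>{1, -1}. \<forall>x\<in>M. \<forall>l m i j. weyl g l m i j x =
     or / 2 * sqrt \<bar>det (g x)\<bar> * (\<Sum>p\<in>UNIV. \<Sum>q\<in>UNIV. \<Sum>a\<in>UNIV. \<Sum>b\<in>UNIV.
       levi_civita_symbol l m p q * matrix_inv (g x) $ p $ a * matrix_inv (g x) $ q $ b *
       weyl g a b i j x))"

definition killing_field :: "(real ^ 4) set \<Rightarrow> metric4 \<Rightarrow> (real ^ 4 \<Rightarrow> real ^ 4) \<Rightarrow> bool" where
  "killing_field M g K \<longleftrightarrow> smooth_on M K \<and>
     (\<forall>x\<in>M. \<forall>i j. (\<Sum>l\<in>UNIV. K x $ l * pd l (\<lambda>y. g y $ i $ j) x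
        + g x $ l $ j * pd i (\<lambda>y. K y $ l) x + g x $ i $ l * pd j (\<lambda>y. K y $ l) x) = 0)"

definition commuting_fields ::
  "(real ^ 4) set \<Rightarrow> (real ^ 4 \<Rightarrow> real ^ 4) \<Rightarrow> (real ^ 4 \<Rightarrow> real ^ 4) \<Rightarrow> bool" where
  "commuting_fields M K L \<longleftrightarrow>
     (\<forall>x\<in>M. frechet_derivative L (at x) (K x) = frechet_derivative K (at x) (L x))"


section \<open>The quotient\<close>

text \<open>
  \<open>horizontal e k G u\<close> consists of the vectors tangent to the zero set at \<open>u\<close> (the kernel of the
  differentials of all \<open>momentum e k Y\<close>) that are orthogonal to the fibre \<open>u \<bbbH>\<close> over the
  quaternionic line of \<open>u\<close> and to the orbit of \<open>G\<close>.
\<close>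

definition horizontal ::
  "('m::finite \<Rightarrow> nat) \<Rightarrow> nat \<Rightarrow> (quat ^ 'm ^ 'm) set \<Rightarrow> quat ^ 'm \<Rightarrow> (quat ^ 'm) set" where
  "horizontal e k G u = {v.
     (\<forall>Y\<in>lie G. hform e k v (Y *v u) + hform e k u (Y *v v) = 0) \<and>
     (\<forall>q. Fkl e k v (rscale u q) = 0) \<and>
     (\<forall>Y\<in>lie G. Fkl e k v (Y *v u) = 0)}"

definition line_orbit :: "(quat ^ 'm::finite ^ 'm) set \<Rightarrow> quat ^ 'm \<Rightarrow> (quat ^ 'm) set" where
  "line_orbit G u = {rscale (A *v u) q | A q. A \<in> G \<and> q \<noteq> 0}"

text \<open>
  The quotient in a chart \<open>M \<subseteq> \<real>\<^sup>4\<close>: \<open>P\<close> is the part of the zero set (a union of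
  quaternionic lines without origin, all negative or all positive) lying over \<open>M\<close>, and
  \<open>\<pi> : P \<rightarrow> M\<close> is the quotient map.

  The two conditions on the fibres of \<open>\<pi>\<close> hold for the global quotient, where the fibres are the
  orbits in \<open>P\<close>, and also for the quotient by the local action (needed when the orbits of \<open>G\<close>
  are not closed), where they are the path components of the intersections of \<open>P\<close> with orbits.

  The derivative of \<open>\<pi>\<close> is only determined on vectors tangent to the zero set; by the
  bijectivity requirement the quotient is a four-manifold at \<open>\<pi> u\<close>. The metric of the space of
  lines is \<open>Fkl v v / \<bar>Fkl u u\<bar>\<close> on vectors \<open>v\<close> orthogonal to \<open>u \<bbbH>\<close>, the positive factor
  being the rescaling of \<open>u\<close> to \<open>\<bar>Fkl u u\<bar> = 1\<close>.
\<close>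

definition semi_QK_quotient ::
  "('m::finite \<Rightarrow> nat) \<Rightarrow> nat \<Rightarrow> (quat ^ 'm ^ 'm) set \<Rightarrow> (quat ^ 'm) set \<Rightarrow>
   (quat ^ 'm \<Rightarrow> real ^ 4) \<Rightarrow> (real ^ 4) set \<Rightarrow> metric4 \<Rightarrow> bool" where
  "semi_QK_quotient e k G P \<pi> M g \<longleftrightarrow>
     open M \<and> connected M \<and> definite_metric M g \<and>
     openin (top_of_set (zero_set e k G)) P \<and>
     (\<forall>u\<in>P. \<forall>q. q \<noteq> 0 \<longrightarrow> rscale u q \<in> P) \<and>
     ((\<forall>u\<in>P. Fkl e k u u < 0) \<or> (\<forall>u\<in>P. 0 < Fkl e k u u)) \<and>
     \<pi> ` P = M \<and> locally_extends_smoothly P \<pi> \<and>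
     (\<forall>u\<in>P. \<forall>v\<in>P. \<pi> u = \<pi> v \<longrightarrow> v \<in> line_orbit G u) \<and>
     (\<forall>u\<in>P. \<forall>v\<in>P. path_component (P \<inter> line_orbit G u) u v \<longrightarrow> \<pi> u = \<pi> v) \<and>
     (\<forall>u\<in>P. \<forall>D. (\<pi> has_derivative D) (at u within P) \<longrightarrow>
        bij_betw D (horizontal e k G u) UNIV \<and>
        (\<forall>v\<in>horizontal e k G u. \<forall>w\<in>horizontal e k G u.
           D v \<bullet> (g (\<pi> u) *v D w) = Fkl e k v w / \<bar>Fkl e k u u\<bar>))"

text \<open>The vector field on \<open>M\<close> given by the infinitesimal action of \<open>X\<close>.\<close>

definition induced_field ::
  "(quat ^ 'm) set \<Rightarrow> (quat ^ 'm \<Rightarrow> real ^ 4) \<Rightarrow> quat ^ 'm::finite ^ 'm \<Rightarrow>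
   (real ^ 4 \<Rightarrow> real ^ 4) \<Rightarrow> bool" where
  "induced_field P \<pi> X K \<longleftrightarrow>
     (\<forall>u\<in>P. \<forall>D. (\<pi> has_derivative D) (at u within P) \<longrightarrow> K (\<pi> u) = D (X *v u))"


section \<open>The hyperbolic plane and eigenfunctions\<close>

definition hyperbolic_plane :: "(real ^ 2 ^ 2) set" where
  "hyperbolic_plane = {A. transpose A = A \<and> (\<forall>v. v \<noteq> 0 \<longrightarrow> 0 < v \<bullet> (A *v v)) \<and> det A = 1}"

definition half_space :: "real \<Rightarrow> real \<Rightarrow> real ^ 2 ^ 2" where
  "half_space \<rho> \<eta> = vector [vector [1 / \<rho>, \<eta> / \<rho>], vector [\<eta> / \<rho>, (\<rho>\<^sup>2 + \<eta>\<^sup>2) / \<rho>]]"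

text \<open>The inverse of \<^const>\<open>half_space\<close>.\<close>

definition rho_of :: "real ^ 2 ^ 2 \<Rightarrow> real" where "rho_of B = 1 / B $ 1 $ 1"
definition eta_of :: "real ^ 2 ^ 2 \<Rightarrow> real" where "eta_of B = B $ 1 $ 2 / B $ 1 $ 1"

definition normalized :: "real ^ 2 ^ 2 \<Rightarrow> real ^ 2 ^ 2" where
  "normalized A = (1 / sqrt (det A)) *\<^sub>R A"

text \<open>The function in half-space coordinates, and its partial derivatives.\<close>

definition coord :: "(real ^ 2 ^ 2 \<Rightarrow> real) \<Rightarrow> real \<Rightarrow> real \<Rightarrow> real" where
  "coord F \<rho> \<eta> = F (half_space \<rho> \<eta>)"

definition d_rho :: "(real \<Rightarrow> real \<Rightarrow> real) \<Rightarrow> real \<Rightarrow> real \<Rightarrow> real" where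
  "d_rho f \<rho> \<eta> = deriv (\<lambda>t. f t \<eta>) \<rho>"
definition d_eta :: "(real \<Rightarrow> real \<Rightarrow> real) \<Rightarrow> real \<Rightarrow> real \<Rightarrow> real" where
  "d_eta f \<rho> \<eta> = deriv (\<lambda>t. f \<rho> t) \<eta>"

definition hyperbolic_eigenfunction :: "(real ^ 2 ^ 2) set \<Rightarrow> (real ^ 2 ^ 2 \<Rightarrow> real) \<Rightarrow> bool" where
  "hyperbolic_eigenfunction \<Omega> F \<longleftrightarrow> openin (top_of_set hyperbolic_plane) \<Omega> \<and>
     Ck_on 2 {p. 0 < fst p \<and> half_space (fst p) (snd p) \<in> \<Omega>} (\<lambda>p. coord F (fst p) (snd p)) \<and>
     (\<forall>\<rho> \<eta>. 0 < \<rho> \<and> half_space \<rho> \<eta> \<in> \<Omega> \<longrightarrow>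
        d_rho (d_rho (coord F)) \<rho> \<eta> + d_eta (d_eta (coord F)) \<rho> \<eta>
          = 3 / (4 * \<rho>\<^sup>2) * coord F \<rho> \<eta>)"

definition half_lift :: "(real ^ 2 ^ 2 \<Rightarrow> real) \<Rightarrow> real ^ 2 ^ 2 \<Rightarrow> real" where
  "half_lift F A = det A powr (1 / 4) * F (normalized A)"


section \<open>The metric generated by an eigenfunction\<close>

definition discr :: "(real ^ 2 ^ 2 \<Rightarrow> real) \<Rightarrow> real \<Rightarrow> real \<Rightarrow> real" where
  "discr F \<rho> \<eta> =
     (coord F \<rho> \<eta>)\<^sup>2 - 4 * \<rho>\<^sup>2 * ((d_rho (coord F) \<rho> \<eta>)\<^sup>2 + (d_eta (coord F) \<rho> \<eta>)\<^sup>2)"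

text \<open>The value of \<open>g\<^sub>F\<close>, as a quadratic form at \<open>(\<rho>, \<eta>)\<close>, on a tangent vector with
  \<open>d\<rho>, d\<eta>, d\<phi>, d\<psi>\<close> components \<open>r, h, p, s\<close>.\<close>

definition gF :: "(real ^ 2 ^ 2 \<Rightarrow> real) \<Rightarrow> real \<Rightarrow> real \<Rightarrow> real \<Rightarrow> real \<Rightarrow> real \<Rightarrow> real \<Rightarrow> real" where
  "gF F \<rho> \<eta> r h p s =
    (let f = coord F \<rho> \<eta>; f\<^sub>\<rho> = d_rho (coord F) \<rho> \<eta>; f\<^sub>\<eta> = d_eta (coord F) \<rho> \<eta>;
         \<alpha> = sqrt \<rho> * p; \<beta> = (s + \<eta> * p) / sqrt \<rho>
     in discr F \<rho> \<eta> / (4 * f\<^sup>2) * ((r\<^sup>2 + h\<^sup>2) / \<rho>\<^sup>2)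
        + (((f - 2 * \<rho> * f\<^sub>\<rho>) * \<alpha> - 2 * \<rho> * f\<^sub>\<eta> * \<beta>)\<^sup>2
           + (- 2 * \<rho> * f\<^sub>\<eta> * \<alpha> + (f + 2 * \<rho> * f\<^sub>\<rho>) * \<beta>)\<^sup>2) / (f\<^sup>2 * discr F \<rho> \<eta>))"

text \<open>\<open>\<rho>, \<eta>, \<phi>, \<psi>\<close> are coordinates on \<open>U\<close> with \<open>\<partial>\<^sub>\<phi> = L1\<close> and \<open>\<partial>\<^sub>\<psi> = L2\<close>.\<close>

definition torus_coordinates ::
  "(real ^ 4) set \<Rightarrow> (real ^ 4 \<Rightarrow> real) \<Rightarrow> (real ^ 4 \<Rightarrow> real) \<Rightarrow> (real ^ 4 \<Rightarrow> real) \<Rightarrow>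
   (real ^ 4 \<Rightarrow> real) \<Rightarrow> (real ^ 4 \<Rightarrow> real ^ 4) \<Rightarrow> (real ^ 4 \<Rightarrow> real ^ 4) \<Rightarrow> bool" where
  "torus_coordinates U \<rho> \<eta> \<phi> \<psi> L1 L2 \<longleftrightarrow>
     smooth_on U (\<lambda>y. (\<rho> y, \<eta> y, \<phi> y, \<psi> y)) \<and> inj_on (\<lambda>y. (\<rho> y, \<eta> y, \<phi> y, \<psi> y)) U \<and>
     (\<forall>y\<in>U. let d = (\<lambda>f. frechet_derivative f (at y)) in
        (\<forall>\<xi>. d \<rho> \<xi> = 0 \<and> d \<eta> \<xi> = 0 \<and> d \<phi> \<xi> = 0 \<and> d \<psi> \<xi> = 0 \<longrightarrow> \<xi> = 0) \<and>
        d \<rho> (L1 y) = 0 \<and> d \<eta> (L1 y) = 0 \<and> d \<phi> (L1 y) = 1 \<and> d \<psi> (L1 y) = 0 \<and>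
        d \<rho> (L2 y) = 0 \<and> d \<eta> (L2 y) = 0 \<and> d \<phi> (L2 y) = 0 \<and> d \<psi> (L2 y) = 1)"

text \<open>\<open>\<Phi> : M \<rightarrow> \<H>\<^sup>2\<close> is the map induced by the Gram matrix; \<open>c\<close> is the
  constant up to which \<open>g\<close> is the metric of \<open>F\<close>. The basis \<open>Y1, Y2\<close> generating
  \<open>\<partial>\<^sub>\<phi>, \<partial>\<^sub>\<psi>\<close> need not be the one used to define \<open>\<Phi>\<close>.\<close>

definition generates ::
  "(quat ^ 'm ^ 'm) set \<Rightarrow> (quat ^ 'm ^ 'm) set \<Rightarrow> (quat ^ 'm::finite) set \<Rightarrow>
   (quat ^ 'm \<Rightarrow> real ^ 4) \<Rightarrow> (real ^ 4) set \<Rightarrow> metric4 \<Rightarrow> (real ^ 4 \<Rightarrow> real ^ 2 ^ 2) \<Rightarrow>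
   (real ^ 2 ^ 2) set \<Rightarrow> (real ^ 2 ^ 2 \<Rightarrow> real) \<Rightarrow> bool" where
  "generates G H P \<pi> M g \<Phi> \<Omega> F \<longleftrightarrow>
     hyperbolic_eigenfunction \<Omega> F \<and> \<Phi> ` M \<subseteq> \<Omega> \<and>
     (\<exists>c Y1 Y2 L1 L2. c \<noteq> 0 \<and> projects_to_basis Y1 Y2 (lie G) (lie H) \<and>
        induced_field P \<pi> Y1 L1 \<and> induced_field P \<pi> Y2 L2 \<and>
        (\<forall>x\<in>M. \<exists>U \<phi> \<psi>. open U \<and> x \<in> U \<and> U \<subseteq> M \<and>
           (let \<rho> = (\<lambda>y. rho_of (\<Phi> y)); \<eta> = (\<lambda>y. eta_of (\<Phi> y)) in
            torus_coordinates U \<rho> \<eta> \<phi> \<psi> L1 L2 \<and>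
            (\<forall>y\<in>U. F (\<Phi> y) \<noteq> 0 \<and> discr F (\<rho> y) (\<eta> y) \<noteq> 0 \<and>
               (let d = (\<lambda>f. frechet_derivative f (at y)) in
                \<forall>\<xi>. \<xi> \<bullet> (g y *v \<xi>) =
                  c * gF F (\<rho> y) (\<eta> y) (d \<rho> \<xi>) (d \<eta> \<xi>) (d \<phi> \<xi>) (d \<psi> \<xi>))))))"

end

theory Submission
  imports Defs
begin

text \<open>
  With \<open>f = F\<^bsub>k,l\<^esub>(u, u)\<close>, the fourth powers of the lift and of \<open>f\<close> are \<open>det A(u) F\<^sup>4\<close> and \<open>f\<^sup>4\<close>.
  Both \<open>F\<^sup>4\<close> and \<open>det A(u) / f\<^sup>4\<close> can be read off, pointwise, from the area that \<open>g\<close> gives to the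
  parallelogram of two Killing fields of the torus.

  On the one hand, in the coframe \<open>\<alpha>, \<beta>\<close>, which has \<open>\<alpha> \<and> \<beta> = d\<phi> \<and> d\<psi>\<close>, the torus
  part of \<open>g\<^sub>F\<close> is the square of a symmetric matrix with determinant
  \<open>D = F\<^sup>2 - 4 \<rho>\<^sup>2 (F\<^sub>\<rho>\<^sup>2 + F\<^sub>\<eta>\<^sup>2)\<close>, divided by \<open>F\<^sup>2 D\<close>. So the Gram determinant of \<open>\<partial>\<^sub>\<phi>, \<partial>\<^sub>\<psi>\<close> is
  \<open>D\<^sup>2 / (F\<^sup>2 D)\<^sup>2 = F\<^sup>-\<^sup>4\<close> (\<open>gF_torus_determinant\<close>), and that of any two fields \<open>K\<^sub>1, K\<^sub>2\<close>
  induced by a basis of \<open>Lie H / Lie G\<close> is a constant multiple of it.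

  On the other hand, let \<open>u\<close> be in the zero set, \<open>x\<^sub>i = \<mu>\<^bsub>X\<^sub>i\<^esub>(u)\<close>, and write \<open>\<langle>v, w\<rangle>\<close> for the
  quaternionic form \<open>v\<^sup>\<dagger> \<F> w\<close>, so that \<open>f = \<langle>u, u\<rangle>\<close>. Decompose \<open>X\<^sub>i u = h\<^sub>i + u q\<^sub>i + Z\<^sub>i u\<close> with \<open>h\<^sub>i\<close>
  horizontal and \<open>Z\<^sub>i\<close> in \<open>Lie G\<close> (\<open>vertical_decomposition\<close>); here \<open>q\<^sub>i = x\<^sub>i / f\<close>. Since \<open>H\<close> is
  abelian, \<open>\<langle>X\<^sub>1 u, X\<^sub>2 u\<rangle>\<close> and \<open>\<langle>Z\<^sub>1 u, Z\<^sub>2 u\<rangle>\<close> are real, so the imaginary parts of \<open>\<langle>h\<^sub>1, h\<^sub>2\<rangle>\<close>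
  and of \<open>f q\<^sub>1\<^sup>* q\<^sub>2\<close> cancel. The horizontal space has real dimension four and is stable
  under right multiplication, so it is one quaternionic line, and there the norm of the
  imaginary part of \<open>\<langle>h\<^sub>1, h\<^sub>2\<rangle>\<close> measures the area of the parallelogram of \<open>h\<^sub>1, h\<^sub>2\<close>; likewise
  that of \<open>q\<^sub>1\<^sup>* q\<^sub>2\<close> measures the area for \<open>q\<^sub>1, q\<^sub>2\<close>. With the rescaling by \<open>\<bar>f\<bar>\<close> in the metric
  this says that \<open>det A(u)\<close> is \<open>f\<^sup>4\<close> times the Gram determinant of \<open>K\<^sub>1, K\<^sub>2\<close>
  (\<open>quotient_gram_determinant\<close>).

  Together, \<open>det A \<cdot> F\<^sup>4\<close> is a positive constant times \<open>f\<^sup>4\<close>. Taking fourth roots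
  determines the lift up to sign, and the sign is constant because \<open>f\<close> has a fixed sign and
  \<open>F\<close> is continuous without zeros over the connected set \<open>M\<close>.
\<close>

section \<open>Quaternions\<close>

lemmas quat_arith = plus_quat_def minus_quat_def uminus_quat_def times_quat_def scaleR_quat_def
  zero_quat_def one_quat_def inner_quat_def qcnj_def

lemma qcnj_simps [simp]:
  "qcnj (p + q) = qcnj p + qcnj q" "qcnj (a *\<^sub>R p) = a *\<^sub>R qcnj p" "qcnj 0 = 0"
  "qcnj (qcnj p) = p" "qcnj (p * q) = qcnj q * qcnj p"
  by (simp_all add: quat_arith quat_eq_iff algebra_simps)

lemma qcnj_sum: "qcnj (sum f A) = (\<Sum>i\<in>A. qcnj (f i))"
  by (induction A rule: infinite_finite_induct) auto

lemma re_simps [simp]: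
  "re (p + q) = re p + re q" "re (a *\<^sub>R p) = a * re p" "re 0 = 0" "re (qcnj p) = re p"
  by (simp_all add: quat_arith)

lemma re_sum: "re (sum f A) = (\<Sum>i\<in>A. re (f i))"
  by (induction A rule: infinite_finite_induct) auto

lemma self_conjugate_is_real:
  assumes "qcnj q = q" shows "q = re q *\<^sub>R 1"
  using assms by (simp add: quat_arith quat_eq_iff)

text \<open>Take \<open>q\<close> to be the conjugate of \<open>p\<close>. This recovers quaternionic identities from identities
  between real parts.\<close>

lemma zero_if_re_multiples_zero:
  assumes "\<And>q. re (p * q) = 0" shows "p = 0"
  using assms[of "qcnj p"] inner_eq_zero_iff[of p]
  by (simp add: quat_arith)

definition qi where "qi = Quat 0 1 0 0"
definition qj where "qj = Quat 0 0 1 0"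
definition qk where "qk = Quat 0 0 0 1"

lemma quat_expand: "q = re q *\<^sub>R 1 + im1 q *\<^sub>R qi + im2 q *\<^sub>R qj + im3 q *\<^sub>R qk"
  by (simp add: quat_arith qi_def qj_def qk_def quat_eq_iff)

text \<open>Lagrange's identity: \<open>\<bar>p\<^sup>* q\<bar>\<^sup>2 = \<bar>p\<bar>\<^sup>2 \<bar>q\<bar>\<^sup>2\<close>, and the real part of \<open>p\<^sup>* q\<close> is the inner
  product, so the imaginary part carries the Gram determinant.\<close>

lemma lagrange_quat:
  "(p \<bullet> p) * (q \<bullet> q) - (p \<bullet> q)\<^sup>2 = (im1 (qcnj p * q))\<^sup>2 + (im2 (qcnj p * q))\<^sup>2 + (im3 (qcnj p * q))\<^sup>2"
  unfolding quat_arith quat.sel by algebra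

lemma dim_quat: "DIM(quat) = 4"
  by (simp add: Basis_quat_def)

section \<open>The quaternionic form\<close>

lemma rscale_simps [simp]:
  "rscale (u + v) q = rscale u q + rscale v q" "rscale u (p + q) = rscale u p + rscale u q"
  "rscale (a *\<^sub>R u) q = a *\<^sub>R rscale u q" "rscale u (a *\<^sub>R q) = a *\<^sub>R rscale u q"
  "rscale u 1 = u" "rscale u 0 = 0" "rscale 0 q = 0"
  "rscale (rscale u p) q = rscale u (p * q)"
  by (simp_all add: rscale_def vec_eq_iff algebra_simps)

lemma matrix_vector_rscale: "(A :: quat ^ 'n::finite ^ 'm) *v rscale u q = rscale (A *v u) q"
  by (simp add: rscale_def vec_eq_iff matrix_vector_mult_def sum_distrib_right mult.assoc)

lemma matrix_vector_scaleR:
  "A *v (a *\<^sub>R u) = a *\<^sub>R (A *v u)" "(a *\<^sub>R A) *v u = a *\<^sub>R (A *v u)"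
  for A :: "quat ^ 'n::finite ^ 'm"
  by (simp_all add: vec_eq_iff matrix_vector_mult_def scaleR_sum_right)

lemma bounded_linear_matrix_vector: "bounded_linear (\<lambda>A :: quat ^ 'm::finite ^ 'm. A *v u)"
  by (rule linear_conv_bounded_linear[THEN iffD1], rule linearI)
    (simp_all add: matrix_vector_mult_add_rdistrib matrix_vector_scaleR)

lemma bounded_bilinear_matrix_product:
  "bounded_bilinear (\<lambda>A B :: quat ^ 'm::finite ^ 'm. A ** B)"
proof (rule bilinear_conv_bounded_bilinear[THEN iffD1], unfold bilinear_def, intro conjI allI linearI)
qed (simp_all add: vec_eq_iff matrix_matrix_mult_def sum.distrib scaleR_sum_right algebra_simps)

lemma hform_add:
  "hform e k (u + v) w = hform e k u w + hform e k v w"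
  "hform e k w (u + v) = hform e k w u + hform e k w v"
  by (simp_all add: hform_def scaleR_add_right sum.distrib algebra_simps)

lemma hform_scaleR:
  "hform e k (a *\<^sub>R u) w = a *\<^sub>R hform e k u w"
  "hform e k w (a *\<^sub>R u) = a *\<^sub>R hform e k w u"
  by (simp_all add: hform_def scaleR_sum_right mult.commute)

lemma hform_zero: "hform e k w 0 = 0"
  using hform_scaleR(2)[of e k w 0 0] by simp

lemma hform_rscale:
  "hform e k (rscale u q) w = qcnj q * hform e k u w"
  "hform e k w (rscale u q) = hform e k w u * q"
  by (simp_all add: hform_def rscale_def sum_distrib_left sum_distrib_right mult.assoc)

lemma qcnj_hform: "qcnj (hform e k u v) = hform e k v u"
  by (simp add: hform_def qcnj_sum)

lemma re_hform: "re (hform e k u v) = Fkl e k u v"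
  by (simp add: hform_def Fkl_def re_sum quat_arith)

lemma hform_self: "hform e k u u = Fkl e k u u *\<^sub>R 1"
  using self_conjugate_is_real[OF qcnj_hform[of e k u u]] by (simp add: re_hform)

text \<open>The real form determines the quaternionic one, because the latter is linear over
  quaternions in its second argument.\<close>

lemma hform_eq_zero_iff: "hform e k u v = 0 \<longleftrightarrow> (\<forall>q. Fkl e k u (rscale v q) = 0)"
proof
  assume "\<forall>q. Fkl e k u (rscale v q) = 0"
  then show "hform e k u v = 0"
    by (intro zero_if_re_multiples_zero) (simp flip: hform_rscale add: re_hform)
qed (simp flip: re_hform add: hform_rscale)

lemma Fkl_commute: "Fkl e k u v = Fkl e k v u"
  by (simp add: Fkl_def inner_commute)

lemma Fkl_add:
  "Fkl e k (u + v) w = Fkl e k u w + Fkl e k v w"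
  "Fkl e k w (u + v) = Fkl e k w u + Fkl e k w v"
  by (simp_all flip: re_hform add: hform_add)

lemma Fkl_scaleR:
  "Fkl e k (a *\<^sub>R u) w = a * Fkl e k u w" "Fkl e k w (a *\<^sub>R u) = a * Fkl e k w u"
  by (simp_all flip: re_hform add: hform_scaleR)

lemma Fkl_rscale_rscale: "Fkl e k (rscale h p) (rscale h q) = Fkl e k h h * (p \<bullet> q)"
proof -
  have "Fkl e k (rscale h p) (rscale h q) = re (qcnj p * (hform e k h h * q))"
    by (simp add: hform_rscale mult.assoc flip: re_hform)
  then show ?thesis
    unfolding hform_self by simp (simp add: quat_arith)
qed

lemma bounded_bilinear_Fkl: "bounded_bilinear (Fkl e k)"
proof (rule bilinear_conv_bounded_bilinear[THEN iffD1], unfold bilinear_def, intro conjI allI linearI)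
qed (simp_all add: Fkl_add Fkl_scaleR)

text \<open>A nondegenerate form satisfies \<open>W\<^sup>\<bottom>\<^sup>\<bottom> = W\<close> even if it is indefinite on \<open>W\<close>: the diagonal
  matrix of signs turns its orthogonal complements into Euclidean ones.\<close>

lemma in_subspace_if_orthogonal_to_complement:
  assumes W: "subspace W" and x: "\<And>v. (\<forall>w\<in>W. Fkl e k v w = 0) \<Longrightarrow> Fkl e k v x = 0"
  shows "x \<in> W"
proof -
  define J where "J v = (\<chi> i. eps e k i *\<^sub>R v $ i)" for v :: "quat ^ 'a"
  have J: "Fkl e k v w = v \<bullet> J w" for v w
    by (simp add: Fkl_def J_def inner_vec_def)
  have JJ: "J (J v) = v" for v
    by (simp add: J_def eps_def vec_eq_iff)
  have "linear J"
    by (rule linearI) (simp_all add: J_def vec_eq_iff algebra_simps)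
  then have sub: "subspace (J ` W)"
    using W by (rule linear_subspace_image)
  have "J x \<in> (J ` W)\<^sup>\<bottom>\<^sup>\<bottom>"
    using x unfolding orthogonal_comp_def by (auto simp: orthogonal_def J inner_commute)
  then have "J x \<in> J ` W"
    using orthogonal_comp_self[OF sub] by simp
  then show ?thesis
    using JJ by (metis image_iff)
qed

section \<open>Abelian groups of isometries and their Lie algebras\<close>

definition infinitesimal_isometry :: "('m::finite \<Rightarrow> nat) \<Rightarrow> nat \<Rightarrow> quat ^ 'm ^ 'm \<Rightarrow> bool" where
  "infinitesimal_isometry e k X \<longleftrightarrow> (\<forall>u v. hform e k (X *v u) v = - hform e k u (X *v v))"

text \<open>Conjugation exchanges the arguments of the form. Moving both matrices to the other side by
  skewness, and then commuting them, undoes the exchange.\<close>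

lemma hform_commuting_real:
  assumes "infinitesimal_isometry e k X" "infinitesimal_isometry e k Y" "X ** Y = Y ** X"
  shows "hform e k (X *v u) (Y *v u) = Fkl e k (X *v u) (Y *v u) *\<^sub>R 1"
proof -
  have "qcnj (hform e k (X *v u) (Y *v u)) = hform e k (Y *v u) (X *v u)"
    by (rule qcnj_hform)
  also have "\<dots> = - hform e k u ((X ** Y) *v u)"
    using assms by (simp add: infinitesimal_isometry_def matrix_vector_mul_assoc)
  also have "\<dots> = hform e k (X *v u) (Y *v u)"
    using assms by (simp add: infinitesimal_isometry_def matrix_vector_mul_assoc)
  finally show ?thesis
    using self_conjugate_is_real by (simp flip: re_hform)
qed

lemma carrier_SpD: "A \<in> carrier (Sp e k) \<Longrightarrow> Fkl e k (A *v u) (A *v u) = Fkl e k u u"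
  by (simp add: Sp_def)

text \<open>Polarization of the quadratic form.\<close>

lemma Sp_preserves_Fkl:
  assumes "A \<in> carrier (Sp e k)"
  shows "Fkl e k (A *v u) (A *v v) = Fkl e k u v"
  using carrier_SpD[OF assms, of u] carrier_SpD[OF assms, of v] carrier_SpD[OF assms, of "u + v"]
  by (simp add: matrix_vector_right_distrib Fkl_add Fkl_commute[of e k v u]
      Fkl_commute[of e k "A *v v" "A *v u"])

lemma Sp_preserves_hform:
  assumes "A \<in> carrier (Sp e k)"
  shows "hform e k (A *v u) (A *v v) = hform e k u v"
proof -
  have "hform e k (A *v u) (A *v v) - hform e k u v = 0"
  proof (rule zero_if_re_multiples_zero)
    fix q
    have "Fkl e k (A *v u) (A *v rscale v q) = Fkl e k u (rscale v q)"
      by (rule Sp_preserves_Fkl[OF assms])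
    then have "re (hform e k (A *v u) (A *v v) * q) = re (hform e k u v * q)"
      unfolding matrix_vector_rscale re_hform[symmetric] hform_rscale .
    then show "re ((hform e k (A *v u) (A *v v) - hform e k u v) * q) = 0"
      by (simp add: left_diff_distrib) (simp add: minus_quat_def)
  qed
  then show ?thesis by simp
qed

lemma abelian_subgroupD:
  assumes "abelian_subgroup G (Sp e k)"
  shows "G \<subseteq> carrier (Sp e k)" "mat 1 \<in> G"
    "\<And>A B. A \<in> G \<Longrightarrow> B \<in> G \<Longrightarrow> A ** B \<in> G" "\<And>A B. A \<in> G \<Longrightarrow> B \<in> G \<Longrightarrow> A ** B = B ** A"
proof -
  have G: "subgroup G (Sp e k)" "comm_group (Sp e k\<lparr>carrier := G\<rparr>)"
    using assms by (simp_all add: abelian_subgroup_def)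
  show "G \<subseteq> carrier (Sp e k)" "mat 1 \<in> G" "\<And>A B. A \<in> G \<Longrightarrow> B \<in> G \<Longrightarrow> A ** B \<in> G"
    using subgroup.subset[OF G(1)] subgroup.one_closed[OF G(1)] subgroup.m_closed[OF G(1)]
    by (simp_all add: Sp_def)
  show "A ** B = B ** A" if "A \<in> G" "B \<in> G" for A B
    using comm_monoid.m_comm[OF comm_group.axioms(1)[OF G(2)], of A B] that by (simp add: Sp_def)
qed

lemma lie_mono: "G \<subseteq> H \<Longrightarrow> lie G \<subseteq> lie H"
  unfolding lie_def by (intro Collect_mono impI) (metis subsetD)

text \<open>Differentiating the invariance of the real form along a one-parameter subgroup gives
  skewness for the real form, hence for the quaternionic form since the matrices commute with
  right scalars.\<close>

lemma lie_infinitesimal_isometry: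
  assumes "G \<subseteq> carrier (Sp e k)" "X \<in> lie G"
  shows "infinitesimal_isometry e k X"
  unfolding infinitesimal_isometry_def
proof (intro allI)
  fix u v
  obtain \<gamma> where \<gamma>: "\<gamma> 0 = mat 1" "\<And>t. \<gamma> t \<in> G" "(\<gamma> has_vector_derivative X) (at 0)"
    using assms(2) unfolding lie_def by blast
  have "Fkl e k (X *v u) v + Fkl e k u (X *v v) = 0" for v
  proof -
    note d = bounded_linear.has_vector_derivative[OF bounded_linear_matrix_vector \<gamma>(3)]
    have "((\<lambda>t. Fkl e k (\<gamma> t *v u) (\<gamma> t *v v)) has_vector_derivative
        Fkl e k u (X *v v) + Fkl e k (X *v u) v) (at 0)"
      using bounded_bilinear.has_vector_derivative[OF bounded_bilinear_Fkl d d, of e k u v] \<gamma>(1)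
      by (simp add: matrix_vector_mul_lid)
    moreover have "(\<lambda>t. Fkl e k (\<gamma> t *v u) (\<gamma> t *v v)) = (\<lambda>t. Fkl e k u v)"
      using assms(1) \<gamma>(2) Sp_preserves_Fkl by blast
    ultimately show ?thesis
      using vector_derivative_unique_at has_vector_derivative_const by (metis add.commute)
  qed
  note skew = this
  have "hform e k (X *v u) v + hform e k u (X *v v) = 0"
  proof (rule zero_if_re_multiples_zero)
    fix q
    show "re ((hform e k (X *v u) v + hform e k u (X *v v)) * q) = 0"
      using skew[of "rscale v q"] unfolding matrix_vector_rscale re_hform[symmetric] hform_rscale
      by (simp add: distrib_right)
  qed
  then show "hform e k (X *v u) v = - hform e k u (X *v v)"
    by (simp add: eq_neg_iff_add_eq_0)
qed

lemma lie_commutes: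
  assumes "X \<in> lie G" and A: "\<And>B. B \<in> G \<Longrightarrow> B ** A = A ** B"
  shows "X ** A = A ** X"
proof -
  obtain \<gamma> where \<gamma>: "\<And>t. \<gamma> t \<in> G" "(\<gamma> has_vector_derivative X) (at 0)"
    using assms(1) unfolding lie_def by blast
  have "((\<lambda>t. \<gamma> t ** A) has_vector_derivative X ** A) (at 0)"
    by (rule bounded_linear.has_vector_derivative[OF
        bounded_bilinear.bounded_linear_left[OF bounded_bilinear_matrix_product] \<gamma>(2)])
  moreover have "((\<lambda>t. A ** \<gamma> t) has_vector_derivative A ** X) (at 0)"
    by (rule bounded_linear.has_vector_derivative[OF
        bounded_bilinear.bounded_linear_right[OF bounded_bilinear_matrix_product] \<gamma>(2)])
  ultimately show ?thesis
    using A[OF \<gamma>(1)] by (simp add: vector_derivative_unique_at)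
qed

text \<open>Commutativity is what makes the pointwise product of two one-parameter subgroups a
  one-parameter subgroup, generated by the sum.\<close>

lemma lie_subspace:
  fixes G :: "(quat ^ 'm::finite ^ 'm) set"
  assumes G: "mat 1 \<in> G" "\<And>A B. A \<in> G \<Longrightarrow> B \<in> G \<Longrightarrow> A ** B \<in> G"
    "\<And>A B. A \<in> G \<Longrightarrow> B \<in> G \<Longrightarrow> A ** B = B ** A"
  shows "subspace (lie G)"
proof (rule subspaceI)
  show "0 \<in> lie G"
    unfolding lie_def using G(1) by (auto intro!: exI[of _ "\<lambda>_. mat 1"] simp: matrix_mul_lid)
next
  fix X Y assume "X \<in> lie G" "Y \<in> lie G"
  obtain \<gamma> where \<gamma>: "\<gamma> 0 = mat 1" "\<And>s t. \<gamma> (s + t) = \<gamma> s ** \<gamma> t" "\<And>t. \<gamma> t \<in> G"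
      "(\<gamma> has_vector_derivative X) (at 0)"
    using \<open>X \<in> lie G\<close> unfolding lie_def by blast
  obtain \<delta> where \<delta>: "\<delta> 0 = mat 1" "\<And>s t. \<delta> (s + t) = \<delta> s ** \<delta> t" "\<And>t. \<delta> t \<in> G"
      "(\<delta> has_vector_derivative Y) (at 0)"
    using \<open>Y \<in> lie G\<close> unfolding lie_def by blast
  have "((\<lambda>t. \<gamma> t ** \<delta> t) has_vector_derivative Y + X) (at 0)"
    using bounded_bilinear.has_vector_derivative[OF bounded_bilinear_matrix_product \<gamma>(4) \<delta>(4)] \<gamma>(1) \<delta>(1)
    by (simp add: matrix_mul_lid matrix_mul_rid)
  moreover have "\<gamma> (s + t) ** \<delta> (s + t) = (\<gamma> s ** \<delta> s) ** (\<gamma> t ** \<delta> t)" for s t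
  proof -
    have "\<gamma> (s + t) ** \<delta> (s + t) = \<gamma> s ** (\<gamma> t ** \<delta> s) ** \<delta> t"
      by (simp add: \<gamma>(2) \<delta>(2) matrix_mul_assoc)
    also have "\<gamma> t ** \<delta> s = \<delta> s ** \<gamma> t"
      by (rule G(3)[OF \<gamma>(3) \<delta>(3)])
    finally show ?thesis
      by (simp add: matrix_mul_assoc)
  qed
  ultimately show "X + Y \<in> lie G"
    unfolding lie_def using G(2) \<gamma> \<delta>
    by (auto intro!: exI[of _ "\<lambda>t. \<gamma> t ** \<delta> t"] simp: matrix_mul_lid add.commute)
next
  fix c X assume "X \<in> lie G"
  obtain \<gamma> where \<gamma>: "\<gamma> 0 = mat 1" "\<And>s t. \<gamma> (s + t) = \<gamma> s ** \<gamma> t" "\<And>t. \<gamma> t \<in> G"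
      "(\<gamma> has_vector_derivative X) (at 0)"
    using \<open>X \<in> lie G\<close> unfolding lie_def by blast
  have "((\<lambda>t. c * t) has_vector_derivative c) (at 0)"
    by (auto intro!: derivative_eq_intros simp flip: has_real_derivative_iff_has_vector_derivative)
  then have "((\<gamma> \<circ> (\<lambda>t. c * t)) has_vector_derivative c *\<^sub>R X) (at 0)"
    by (rule vector_diff_chain_at) (simp add: \<gamma>(4))
  then show "c *\<^sub>R X \<in> lie G"
    unfolding lie_def using \<gamma>
    by (auto intro!: exI[of _ "\<lambda>t. \<gamma> (c * t)"] simp: distrib_left o_def)
qed

text \<open>By the group law, continuity at \<open>0\<close> propagates to all times.\<close>

lemma one_parameter_group_continuous:
  fixes \<gamma> :: "real \<Rightarrow> quat ^ 'm::finite ^ 'm"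
  assumes "\<gamma> 0 = mat 1" "\<And>s t. \<gamma> (s + t) = \<gamma> s ** \<gamma> t" "(\<gamma> has_vector_derivative X) (at 0)"
  shows "isCont \<gamma> t"
proof -
  have "\<gamma> \<midarrow>0\<rightarrow> mat 1"
    using has_vector_derivative_continuous[OF assms(3)] assms(1) by (simp add: isCont_def)
  then have "(\<lambda>h. \<gamma> t ** \<gamma> h) \<midarrow>0\<rightarrow> \<gamma> t ** mat 1"
    by (rule bounded_bilinear.tendsto[OF bounded_bilinear_matrix_product tendsto_const])
  then show ?thesis
    by (simp add: isCont_iff assms(2) matrix_mul_rid)
qed

lemma zero_set_invariant:
  assumes G: "G \<subseteq> carrier (Sp e k)" "\<And>A B. A \<in> G \<Longrightarrow> B \<in> G \<Longrightarrow> A ** B = B ** A"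
    and "A \<in> G" "u \<in> zero_set e k G"
  shows "A *v u \<in> zero_set e k G"
  unfolding zero_set_def
proof (intro CollectI ballI)
  fix Y assume Y: "Y \<in> lie G"
  have "Y ** A = A ** Y"
    using lie_commutes[OF Y] G(2) \<open>A \<in> G\<close> by blast
  then have "momentum e k Y (A *v u) = hform e k (A *v u) (A *v (Y *v u))"
    by (simp add: momentum_def matrix_vector_mul_assoc)
  also have "\<dots> = momentum e k Y u"
    using G(1) \<open>A \<in> G\<close> by (simp add: momentum_def Sp_preserves_hform subset_iff)
  finally show "momentum e k Y (A *v u) = 0"
    using assms(4) Y by (simp add: zero_set_def)
qed

section \<open>Splitting off the vertical directions\<close>

text \<open>The tangent vector \<open>X u\<close> to the torus orbit splits into a horizontal vector, a vector along the
  quaternionic line of \<open>u\<close>, and one along the orbit of \<open>G\<close>, whose Lie algebra is \<open>L\<close>. The issue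
  is that the orthogonal complement of the horizontal space \<open>h \<bbbH>\<close> is the quaternionic span \<open>W\<close>
  of \<open>u\<close> and \<open>L u\<close>, whereas only real multiples of \<open>L u\<close> are wanted. The imaginary parts
  disappear because \<open>L u\<close> has real pairings with \<open>L u\<close> and with \<open>X u\<close>: a vector of \<open>L u\<close> that occurs
  with an imaginary coefficient is orthogonal to \<open>L u\<close> and to \<open>u\<close>, hence horizontal and null, and
  \<open>h \<bbbH>\<close> contains no null vectors except zero.\<close>

lemma vertical_decomposition:
  assumes L: "subspace L" "\<And>Y. Y \<in> L \<Longrightarrow> infinitesimal_isometry e k Y"
      "\<And>Y Z. Y \<in> L \<Longrightarrow> Z \<in> L \<Longrightarrow> Y ** Z = Z ** Y"
    and mom: "\<And>Y. Y \<in> L \<Longrightarrow> hform e k u (Y *v u) = 0"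
    and hor: "\<And>v. (hform e k u v = 0 \<and> (\<forall>Y\<in>L. hform e k (Y *v u) v = 0)) \<longleftrightarrow> v \<in> range (rscale h)"
    and h: "Fkl e k h h \<noteq> 0"
    and X: "infinitesimal_isometry e k X" "\<And>Y. Y \<in> L \<Longrightarrow> X ** Y = Y ** X"
  obtains r q Z where "Z \<in> L" "X *v u = rscale h r + rscale u q + Z *v u"
proof -
  have h_in: "h \<in> range (rscale h)"
    by (rule range_eqI[of _ _ 1]) simp
  have mom': "hform e k (Y *v u) u = 0" if "Y \<in> L" for Y
    using mom[OF that] qcnj_hform[of e k u "Y *v u"] by simp
  define r where "r = (1 / Fkl e k h h) *\<^sub>R hform e k h (X *v u)"
  define w where "w = X *v u - rscale h r"
  have Xu: "X *v u = rscale h r + w"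
    by (simp add: w_def)
  have hw: "hform e k h w = 0"
  proof -
    have "hform e k h (X *v u) = hform e k h h * r + hform e k h w"
      by (simp add: Xu hform_add hform_rscale)
    then show ?thesis
      using h by (simp add: hform_self r_def)
  qed
  \<comment> \<open>Since \<open>L\<close> is a real subspace, real coefficients of the four quaternion units suffice to
    describe the quaternionic span.\<close>
  define f where "f = (\<lambda>(q, Y0, Y1, Y2, Y3). rscale u q + Y0 *v u + rscale (Y1 *v u) qi +
      rscale (Y2 *v u) qj + rscale (Y3 *v u) qk)"
  define W where "W = f ` (UNIV \<times> L \<times> L \<times> L \<times> L)"
  have "linear f"
    by (rule linearI) (auto simp: f_def matrix_vector_mult_add_rdistrib matrix_vector_scaleR
        scaleR_add_right algebra_simps)
  then have W: "subspace W"
    unfolding W_def by (intro linear_subspace_image subspace_Times L subspace_UNIV)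
  have "w \<in> W"
  proof (rule in_subspace_if_orthogonal_to_complement[OF W])
    fix v assume v: "\<forall>y\<in>W. Fkl e k v y = 0"
    have "f (q, 0, 0, 0, 0) \<in> W" for q
      unfolding W_def using L(1) by (intro imageI) (auto simp: subspace_0)
    then have "hform e k v u = 0"
      unfolding hform_eq_zero_iff using v by (simp add: f_def)
    moreover have "hform e k v (Y *v u) = 0" if Y: "Y \<in> L" for Y
      unfolding hform_eq_zero_iff
    proof
      fix q
      have "rscale (Y *v u) q = rscale (Y *v u) (re q *\<^sub>R 1 + im1 q *\<^sub>R qi + im2 q *\<^sub>R qj + im3 q *\<^sub>R qk)"
        by (subst quat_expand) (rule refl)
      also have "\<dots> = f (0, re q *\<^sub>R Y, im1 q *\<^sub>R Y, im2 q *\<^sub>R Y, im3 q *\<^sub>R Y)"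
        by (simp add: f_def matrix_vector_scaleR)
      also have "\<dots> \<in> W"
        unfolding W_def using L(1) Y by (intro imageI) (auto simp: subspace_scale)
      finally show "Fkl e k v (rscale (Y *v u) q) = 0"
        using v by simp
    qed
    ultimately have "v \<in> range (rscale h)"
      unfolding hor[symmetric] by (metis qcnj_hform qcnj_simps(3))
    then show "Fkl e k v w = 0"
      by (auto simp: hform_rscale hw simp flip: re_hform)
  qed
  then obtain q Y0 Y1 Y2 Y3 where Y: "Y0 \<in> L" "Y1 \<in> L" "Y2 \<in> L" "Y3 \<in> L"
    and w: "w = rscale u q + Y0 *v u + rscale (Y1 *v u) qi + rscale (Y2 *v u) qj + rscale (Y3 *v u) qk"
    by (auto simp: W_def f_def)
  \<comment> \<open>Comparing the imaginary units in the pairing of \<open>Z u\<close> with \<open>w\<close>, which is real.\<close>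
  have orth: "Fkl e k (Z *v u) (Y1 *v u) = 0 \<and> Fkl e k (Z *v u) (Y2 *v u) = 0
      \<and> Fkl e k (Z *v u) (Y3 *v u) = 0" if Z: "Z \<in> L" for Z
  proof -
    have "hform e k (Z *v u) h = 0"
      using hor h_in Z by blast
    then have "Fkl e k (Z *v u) (X *v u) *\<^sub>R 1 = hform e k (Z *v u) w"
      using hform_commuting_real[of e k Z X u] X L(2) Z
      by (simp add: Xu hform_add hform_rscale)
    also have "\<dots> = Fkl e k (Z *v u) (Y0 *v u) *\<^sub>R 1 + Fkl e k (Z *v u) (Y1 *v u) *\<^sub>R qi
        + Fkl e k (Z *v u) (Y2 *v u) *\<^sub>R qj + Fkl e k (Z *v u) (Y3 *v u) *\<^sub>R qk"
      using L(2,3) Z Y mom' by (simp add: w hform_add hform_rscale hform_commuting_real)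
    finally show ?thesis
      by (simp add: quat_arith qi_def qj_def qk_def)
  qed
  have vanish: "Y' *v u = 0" if Y': "Y' \<in> L" and *: "\<And>Z. Z \<in> L \<Longrightarrow> Fkl e k (Z *v u) (Y' *v u) = 0" for Y'
  proof -
    have "hform e k (Z *v u) (Y' *v u) = 0" if "Z \<in> L" for Z
      using hform_commuting_real[of e k Z Y' u] L(2,3) *[OF that] that Y' by simp
    then have "Y' *v u \<in> range (rscale h)"
      using hor mom Y' by blast
    then obtain s where s: "Y' *v u = rscale h s" by auto
    have "Fkl e k h h * (s \<bullet> s) = 0"
      using *[OF Y'] unfolding s Fkl_rscale_rscale .
    then show ?thesis
      using h by (simp add: s)
  qed
  have "Y1 *v u = 0" "Y2 *v u = 0" "Y3 *v u = 0"
    using vanish orth Y by blast+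
  then have "X *v u = rscale h r + rscale u q + Y0 *v u"
    by (simp add: Xu w)
  with Y(1) show ?thesis by (rule that)
qed

text \<open>Expanding the real number \<open>\<langle>X\<^sub>1 u, X\<^sub>2 u\<rangle>\<close> along the orthogonal decompositions relates the
  imaginary parts of \<open>r\<^sub>1\<^sup>* r\<^sub>2\<close> and \<open>q\<^sub>1\<^sup>* q\<^sub>2\<close>, whose norms give the two Gram determinants by
  Lagrange's identity.\<close>

lemma det_momenta_eq_det_horizontal:
  fixes h u :: "quat ^ 'm::finite"
  assumes orth: "hform e k u h = 0" "hform e k (Z1 *v u) h = 0" "hform e k (Z2 *v u) h = 0"
    and mom: "hform e k u (Z1 *v u) = 0" "hform e k u (Z2 *v u) = 0"
    and dec: "X1 *v u = rscale h r1 + rscale u q1 + Z1 *v u" "X2 *v u = rscale h r2 + rscale u q2 + Z2 *v u"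
    and rX: "hform e k (X1 *v u) (X2 *v u) = Fkl e k (X1 *v u) (X2 *v u) *\<^sub>R 1"
    and rZ: "hform e k (Z1 *v u) (Z2 *v u) = Fkl e k (Z1 *v u) (Z2 *v u) *\<^sub>R 1"
  shows "det (gram e k X1 X2 u) = (Fkl e k u u)\<^sup>2 *
    (Fkl e k (rscale h r1) (rscale h r1) * Fkl e k (rscale h r2) (rscale h r2)
      - (Fkl e k (rscale h r1) (rscale h r2))\<^sup>2)"
proof -
  define a b where "a = Fkl e k u u" and "b = Fkl e k h h"
  have orth': "hform e k h u = 0" "hform e k h (Z1 *v u) = 0" "hform e k h (Z2 *v u) = 0"
      "hform e k (Z1 *v u) u = 0"
    using orth mom by (metis qcnj_hform qcnj_simps(3))+
  have "hform e k (X1 *v u) (X2 *v u)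
      = b *\<^sub>R (qcnj r1 * r2) + a *\<^sub>R (qcnj q1 * q2) + hform e k (Z1 *v u) (Z2 *v u)"
    unfolding dec using orth orth' mom
    by (simp add: hform_add hform_rscale hform_self a_def b_def)
  then have "b *\<^sub>R (qcnj r1 * r2) + a *\<^sub>R (qcnj q1 * q2)
      = (Fkl e k (X1 *v u) (X2 *v u) - Fkl e k (Z1 *v u) (Z2 *v u)) *\<^sub>R 1"
    by (simp add: rX rZ algebra_simps)
  then have im: "a * im1 (qcnj q1 * q2) = - b * im1 (qcnj r1 * r2)"
      "a * im2 (qcnj q1 * q2) = - b * im2 (qcnj r1 * r2)"
      "a * im3 (qcnj q1 * q2) = - b * im3 (qcnj r1 * r2)"
    by (simp_all add: quat_eq_iff plus_quat_def scaleR_quat_def one_quat_def)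
  have x: "momentum e k X1 u = a *\<^sub>R q1" "momentum e k X2 u = a *\<^sub>R q2"
    unfolding momentum_def dec using orth mom by (simp_all add: hform_add hform_rscale hform_self a_def)
  have "det (gram e k X1 X2 u) = a\<^sup>2 * (a\<^sup>2 * ((q1 \<bullet> q1) * (q2 \<bullet> q2) - (q1 \<bullet> q2)\<^sup>2))"
    by (simp add: gram_def x det_2 vector_2 inner_commute power2_eq_square algebra_simps)
  also have "a\<^sup>2 * ((q1 \<bullet> q1) * (q2 \<bullet> q2) - (q1 \<bullet> q2)\<^sup>2)
      = (a * im1 (qcnj q1 * q2))\<^sup>2 + (a * im2 (qcnj q1 * q2))\<^sup>2 + (a * im3 (qcnj q1 * q2))\<^sup>2"
    unfolding lagrange_quat by (simp add: power_mult_distrib distrib_left)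
  also have "\<dots> = b\<^sup>2 * ((r1 \<bullet> r1) * (r2 \<bullet> r2) - (r1 \<bullet> r2)\<^sup>2)"
    unfolding lagrange_quat im by (simp add: power_mult_distrib distrib_left)
  finally show ?thesis
    by (simp add: Fkl_rscale_rscale a_def b_def power_mult_distrib right_diff_distrib power2_eq_square mult_ac)
qed

text \<open>For skew \<open>Y\<close>, tangency to the zero set says that the imaginary part of \<open>\<langle>Y u, v\<rangle>\<close>
  vanishes, and orthogonality to the orbit that its real part does.\<close>

lemma horizontal_iff:
  assumes "\<And>Y. Y \<in> lie G \<Longrightarrow> infinitesimal_isometry e k Y"
  shows "v \<in> horizontal e k G u \<longleftrightarrow> hform e k u v = 0 \<and> (\<forall>Y\<in>lie G. hform e k (Y *v u) v = 0)"
proof -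
  have "hform e k v (Y *v u) + hform e k u (Y *v v) = 0 \<and> Fkl e k v (Y *v u) = 0 \<longleftrightarrow>
      hform e k (Y *v u) v = 0" if "Y \<in> lie G" for Y
  proof -
    define p where "p = hform e k (Y *v u) v"
    have "hform e k v (Y *v u) = qcnj p" "hform e k u (Y *v v) = - p"
      using assms[OF that] qcnj_hform[of e k "Y *v u" v]
      by (simp_all add: p_def infinitesimal_isometry_def)
    moreover have "Fkl e k v (Y *v u) = re p"
      unfolding p_def re_hform by (rule Fkl_commute)
    ultimately show ?thesis
      unfolding p_def[symmetric] by (simp add: quat_arith quat_eq_iff) auto
  qed
  moreover have "(\<forall>q. Fkl e k v (rscale u q) = 0) \<longleftrightarrow> hform e k u v = 0"
    unfolding hform_eq_zero_iff[symmetric] by (metis qcnj_hform qcnj_simps(3))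
  ultimately show ?thesis
    unfolding horizontal_def by blast
qed

text \<open>By the bijection \<open>D\<close> the horizontal space has real dimension four, as has the quaternionic line of
  any of its non-null vectors, which it contains.\<close>

lemma horizontal_quaternionic_line:
  fixes D :: "quat ^ 'm::finite \<Rightarrow> real ^ 4"
  assumes iso: "\<And>Y. Y \<in> lie G \<Longrightarrow> infinitesimal_isometry e k Y"
    and "linear D" and bij: "bij_betw D (horizontal e k G u) UNIV"
    and aniso: "\<And>v. v \<in> horizontal e k G u \<Longrightarrow> D v \<noteq> 0 \<Longrightarrow> Fkl e k v v \<noteq> 0"
  obtains h where "horizontal e k G u = range (rscale h)" "Fkl e k h h \<noteq> 0"
proof -
  let ?S = "horizontal e k G u"
  have sub: "subspace ?S"
    by (rule subspaceI) (auto simp: horizontal_iff[OF iso] hform_add hform_scaleR hform_zero)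
  obtain h where h: "h \<in> ?S" "D h = axis 1 1"
    using bij by (metis UNIV_I bij_betw_def image_iff)
  then have Fh: "Fkl e k h h \<noteq> 0"
    using aniso by simp
  have lin: "linear (rscale h)"
    by (rule linearI) simp_all
  have "inj (rscale h)"
    unfolding linear_injective_0[OF lin]
  proof (intro allI impI)
    fix q assume "rscale h q = 0"
    then have "Fkl e k h h * (q \<bullet> q) = 0"
      by (metis Fkl_rscale_rscale Fkl_scaleR(1) mult_zero_left scaleR_zero_left)
    then show "q = 0" using Fh by simp
  qed
  then have "dim (range (rscale h)) = 4"
    using dim_image_eq[OF lin, of UNIV] by (simp add: dim_quat)
  moreover have "dim ?S = 4"
  proof -
    have "inj_on D (span ?S)"
      using bij sub by (simp add: bij_betw_def span_eq_iff[THEN iffD2])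
    then have "dim (D ` ?S) = dim ?S"
      by (rule dim_image_eq[OF \<open>linear D\<close>])
    then show ?thesis
      using bij by (simp add: bij_betw_def)
  qed
  moreover have "range (rscale h) \<subseteq> ?S"
    using h(1) by (auto simp: horizontal_iff[OF iso] hform_rscale)
  ultimately have "range (rscale h) = ?S"
    using subspace_dim_equal[OF linear_subspace_image[OF lin subspace_UNIV] sub] by simp
  with Fh show ?thesis
    using that by metis
qed

section \<open>The derivative of the quotient map\<close>

lemma smooth_on_has_derivative:
  assumes "smooth_on U f" "x \<in> U"
  obtains f' where "(f has_derivative f') (at x)"
  using assms unfolding smooth_on_def by (metis Ck_on.simps(2))

lemma extension_has_derivative_within:
  assumes "locally_extends_smoothly P f" "u \<in> P"
  obtains D where "(f has_derivative D) (at u within P)"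
proof -
  obtain U f' where U: "open U" "u \<in> U" "smooth_on U f'" "\<forall>v\<in>U \<inter> P. f' v = f v"
    using assms unfolding locally_extends_smoothly_def by blast
  obtain D where "(f' has_derivative D) (at u)"
    using U(3,2) by (rule smooth_on_has_derivative)
  then have "(f' has_derivative D) (at u within P)"
    by (rule has_derivative_at_withinI)
  moreover obtain d where "d > 0" "\<And>v. dist v u < d \<Longrightarrow> v \<in> U"
    using U(1,2) by (auto simp: open_dist)
  ultimately have "(f has_derivative D) (at u within P)"
    using U(4) assms(2) by (auto intro: has_derivative_transform_within)
  then show ?thesis by (rule that)
qed

text \<open>A curve within the fibre set \<open>P \<inter> C\<close> stays in one path component, where \<open>\<pi>\<close> is constant. The
  chain rule then kills its initial velocity.\<close>

lemma derivative_vanishes_along_fibre: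
  fixes c :: "real \<Rightarrow> 'a::real_normed_vector" and \<pi> :: "'a \<Rightarrow> 'b::real_normed_vector"
  assumes D: "(\<pi> has_derivative D) (at u within P)"
    and fib: "\<forall>v\<in>P. path_component (P \<inter> C) u v \<longrightarrow> \<pi> u = \<pi> v"
    and c: "c 0 = u" "(c has_vector_derivative v) (at 0)" "continuous_on {-\<delta><..<\<delta>} c"
    and "0 < \<delta>" and in_fibre: "\<And>t. \<bar>t\<bar> < \<delta> \<Longrightarrow> c t \<in> P \<inter> C"
  shows "D v = 0"
proof -
  let ?S = "{-\<delta><..<\<delta>}"
  have sub: "c ` ?S \<subseteq> P \<inter> C"
    using in_fibre by (auto simp: abs_less_iff)
  have "path_connected (c ` ?S)"
    using c(3) by (intro path_connected_continuous_image convex_imp_path_connected) auto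
  then have "path_component (P \<inter> C) u (c t)" if "t \<in> ?S" for t
    using sub that \<open>0 < \<delta>\<close> c(1) unfolding path_connected_component
    by (intro path_component_of_subset[OF sub]) force
  then have const: "\<pi> (c t) = \<pi> u" if "t \<in> ?S" for t
    using fib sub that by fastforce
  have "(c has_derivative (\<lambda>t. t *\<^sub>R v)) (at 0 within ?S)"
    using c(2) by (simp add: has_vector_derivative_def has_derivative_at_withinI)
  moreover have "(\<pi> has_derivative D) (at (c 0) within c ` ?S)"
    unfolding c(1) by (rule has_derivative_subset[OF D]) (use sub in auto)
  ultimately have "((\<lambda>t. \<pi> (c t)) has_derivative (\<lambda>t. D (t *\<^sub>R v))) (at 0 within ?S)"
    by (rule has_derivative_in_compose)
  then have "((\<lambda>t. \<pi> (c t)) has_derivative (\<lambda>t. D (t *\<^sub>R v))) (at 0)"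
    using \<open>0 < \<delta>\<close> by (simp add: at_within_open[of 0 ?S])
  then have "((\<lambda>t. \<pi> u) has_derivative (\<lambda>t. D (t *\<^sub>R v))) (at 0)"
    by (rule has_derivative_transform_within_open[OF _ open_greaterThanLessThan[of "-\<delta>" \<delta>]]) (use \<open>0 < \<delta>\<close> const in auto)
  then have "(\<lambda>t. D (t *\<^sub>R v)) = (\<lambda>t. 0)"
    using has_derivative_unique has_derivative_const by blast
  then show ?thesis
    by (metis scaleR_one)
qed

lemma derivative_vanishes_on_rscale:
  fixes \<pi> :: "quat ^ 'm::finite \<Rightarrow> 'b::real_normed_vector"
  assumes D: "(\<pi> has_derivative D) (at u within P)"
    and fib: "\<forall>v\<in>P. path_component (P \<inter> line_orbit G u) u v \<longrightarrow> \<pi> u = \<pi> v"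
    and P: "\<And>q. q \<noteq> 0 \<Longrightarrow> rscale u q \<in> P" and "mat 1 \<in> G"
  shows "D (rscale u q) = 0"
\<comment> \<open>For \<open>t\<close> within this \<open>\<delta>\<close> the scalar \<open>1 + t q\<close> cannot vanish.\<close>
proof (rule derivative_vanishes_along_fibre[OF D fib, where c = "\<lambda>t. rscale u (1 + t *\<^sub>R q)"
      and \<delta> = "1 / (norm q + 1)"])
  have eq: "rscale u (1 + t *\<^sub>R q) = u + t *\<^sub>R rscale u q" for t by simp
  show "((\<lambda>t. rscale u (1 + t *\<^sub>R q)) has_vector_derivative rscale u q) (at 0)"
    unfolding eq by (auto intro!: derivative_eq_intros)
  show "continuous_on {- (1 / (norm q + 1))<..<1 / (norm q + 1)} (\<lambda>t. rscale u (1 + t *\<^sub>R q))"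
    unfolding eq by (intro continuous_intros)
  fix t assume t: "\<bar>t\<bar> < 1 / (norm q + 1)"
  have "norm (t *\<^sub>R q) < 1"
  proof -
    have "\<bar>t\<bar> * (norm q + 1) < 1"
      using t by (simp add: pos_less_divide_eq add_nonneg_pos)
    then show ?thesis
      by (simp add: distrib_left)
  qed
  then have "1 + t *\<^sub>R q \<noteq> 0"
    by (metis add.inverse_unique less_irrefl norm_minus_cancel norm_one)
  then show "rscale u (1 + t *\<^sub>R q) \<in> P \<inter> line_orbit G u"
    using P \<open>mat 1 \<in> G\<close> unfolding line_orbit_def by (auto simp del: rscale_simps intro!: exI[of _ "mat 1"] exI[of _ "1 + t *\<^sub>R q"] simp: matrix_vector_mul_lid)
next
  show "rscale u (1 + 0 *\<^sub>R q) = u" by simp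
  show "0 < 1 / (norm q + 1)"
    by (metis norm_ge_zero add_nonneg_pos zero_less_one divide_pos_pos)
qed

text \<open>The orbit stays in the invariant set \<open>N\<close>, so for small times in its open subset \<open>P\<close>.\<close>

lemma derivative_vanishes_on_orbit:
  fixes \<pi> :: "quat ^ 'm::finite \<Rightarrow> 'b::real_normed_vector"
  assumes D: "(\<pi> has_derivative D) (at u within P)"
    and fib: "\<forall>v\<in>P. path_component (P \<inter> line_orbit G u) u v \<longrightarrow> \<pi> u = \<pi> v"
    and P: "openin (top_of_set N) P" "u \<in> P" and inv: "\<And>A. A \<in> G \<Longrightarrow> A *v u \<in> N"
    and "Y \<in> lie G"
  shows "D (Y *v u) = 0"
proof -
  obtain \<gamma> where \<gamma>: "\<gamma> 0 = mat 1" "\<And>s t. \<gamma> (s + t) = \<gamma> s ** \<gamma> t" "\<And>t. \<gamma> t \<in> G"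
      "(\<gamma> has_vector_derivative Y) (at 0)"
    using \<open>Y \<in> lie G\<close> unfolding lie_def by blast
  define c where "c t = \<gamma> t *v u" for t
  have cont: "isCont c t" for t
    unfolding c_def
    by (rule bounded_linear.isCont[OF bounded_linear_matrix_vector]) (rule one_parameter_group_continuous[OF \<gamma>(1,2,4)])
  have c0: "c 0 = u"
    by (simp add: c_def \<gamma>(1) matrix_vector_mul_lid)
  obtain V where V: "open V" "P = N \<inter> V"
    using P(1) by (auto simp: openin_open)
  have "\<forall>\<^sub>F t in at 0. c t \<in> V"
    using cont[of 0] V P(2) c0 by (auto simp: isCont_def intro: topological_tendstoD)
  then obtain \<delta> where \<delta>: "\<delta> > 0" "\<And>t. t \<noteq> 0 \<Longrightarrow> dist t 0 < \<delta> \<Longrightarrow> c t \<in> V"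
    by (auto simp: eventually_at)
  show ?thesis
  proof (rule derivative_vanishes_along_fibre[OF D fib, where c = c and \<delta> = \<delta>])
    show "(c has_vector_derivative Y *v u) (at 0)"
      unfolding c_def by (rule bounded_linear.has_vector_derivative[OF bounded_linear_matrix_vector \<gamma>(4)])
    show "continuous_on {-\<delta><..<\<delta>} c"
      using cont by (simp add: continuous_at_imp_continuous_on)
    fix t :: real assume "\<bar>t\<bar> < \<delta>"
    then have "c t \<in> P"
      using \<delta>(2)[of t] inv[OF \<gamma>(3)] V c0 P(2) by (cases "t = 0") (auto simp: c_def)
    moreover have "c t \<in> line_orbit G u"
      unfolding line_orbit_def c_def using \<gamma>(3) by (auto intro!: exI[of _ "\<gamma> t"] exI[of _ "1::quat"])
    ultimately show "c t \<in> P \<inter> line_orbit G u" by simp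
  qed (use c0 \<delta> in auto)
qed

section \<open>Gram determinants on the quotient\<close>

text \<open>The derivative of the quotient map kills the vertical part of \<open>X\<^sub>i u\<close>, so the Gram matrix of the
  induced fields is that of the horizontal parts, divided by \<open>\<bar>Fkl u u\<bar>\<close>. This factor enters the
  determinant twice, which turns the square of \<open>Fkl u u\<close> into its fourth power.\<close>

lemma quotient_gram_determinant:
  fixes \<pi> :: "quat ^ 'm::finite \<Rightarrow> real ^ 4"
  assumes G: "abelian_subgroup G (Sp e k)" and H: "abelian_subgroup H (Sp e k)" "G \<subseteq> H"
    and X: "X1 \<in> lie H" "X2 \<in> lie H"
    and Q: "semi_QK_quotient e k G P \<pi> M g"
    and K: "induced_field P \<pi> X1 K1" "induced_field P \<pi> X2 K2" and u: "u \<in> P"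
  shows "det (gram e k X1 X2 u) = Fkl e k u u ^ 4 *
    ((K1 (\<pi> u) \<bullet> (g (\<pi> u) *v K1 (\<pi> u))) * (K2 (\<pi> u) \<bullet> (g (\<pi> u) *v K2 (\<pi> u)))
      - (K1 (\<pi> u) \<bullet> (g (\<pi> u) *v K2 (\<pi> u)))\<^sup>2)"
proof -
  note GD = abelian_subgroupD[OF G] and HD = abelian_subgroupD[OF H(1)]
  have mono: "lie G \<subseteq> lie H" using H(2) by (rule lie_mono)
  have isoH: "infinitesimal_isometry e k Y" if "Y \<in> lie H" for Y
    using lie_infinitesimal_isometry[OF HD(1) that] .
  have iso: "infinitesimal_isometry e k Y" if "Y \<in> lie G" for Y
    using isoH that mono by blast
  have comm: "Y ** Z = Z ** Y" if "Y \<in> lie H" "Z \<in> lie H" for Y Z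
  proof (rule lie_commutes[OF that(1)])
    fix B assume "B \<in> H"
    show "B ** Z = Z ** B"
      by (rule lie_commutes[OF that(2), symmetric]) (use HD(4) \<open>B \<in> H\<close> in blast)
  qed
  have M: "\<pi> ` P = M" "definite_metric M g"
    and N: "openin (top_of_set (zero_set e k G)) P"
    and fib: "\<forall>v\<in>P. path_component (P \<inter> line_orbit G u) u v \<longrightarrow> \<pi> u = \<pi> v"
    and resc: "\<And>q. q \<noteq> 0 \<Longrightarrow> rscale u q \<in> P"
    and ext: "locally_extends_smoothly P \<pi>" and Fu: "Fkl e k u u \<noteq> 0"
    using Q u unfolding semi_QK_quotient_def by (blast, blast, blast, blast, blast, blast, force)
  obtain D where D: "(\<pi> has_derivative D) (at u within P)"
    using ext u by (rule extension_has_derivative_within)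
  have bij: "bij_betw D (horizontal e k G u) UNIV"
    and met: "\<And>v w. v \<in> horizontal e k G u \<Longrightarrow> w \<in> horizontal e k G u \<Longrightarrow>
        D v \<bullet> (g (\<pi> u) *v D w) = Fkl e k v w / \<bar>Fkl e k u u\<bar>"
    using Q u D unfolding semi_QK_quotient_def by blast+
  have linD: "linear D"
    using D by (rule has_derivative_linear)
  have uN: "u \<in> zero_set e k G"
    using N u openin_imp_subset by blast
  then have mom: "hform e k u (Y *v u) = 0" if "Y \<in> lie G" for Y
    using that by (simp add: zero_set_def momentum_def)
  have Dresc: "D (rscale u q) = 0" for q
    by (rule derivative_vanishes_on_rscale[OF D fib resc GD(2)])
  have Dorb: "D (Y *v u) = 0" if "Y \<in> lie G" for Y
    by (rule derivative_vanishes_on_orbit[OF D fib N u _ that])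
      (rule zero_set_invariant[OF GD(1,4) _ uN])
  have aniso: "Fkl e k v v \<noteq> 0" if "v \<in> horizontal e k G u" "D v \<noteq> 0" for v
  proof -
    have "D v \<bullet> (g (\<pi> u) *v D v) \<noteq> 0"
      using M u that(2) unfolding definite_metric_def by (metis image_eqI less_irrefl)
    then show ?thesis
      using met[OF that(1) that(1)] by auto
  qed
  obtain h where hor: "horizontal e k G u = range (rscale h)" and h: "Fkl e k h h \<noteq> 0"
    using horizontal_quaternionic_line[OF iso linD bij aniso] by blast
  have hor_in: "rscale h r \<in> horizontal e k G u" for r
    using hor by simp
  have "h \<in> horizontal e k G u"
    using hor_in[of 1] by simp
  then have orth: "hform e k u h = 0" "\<And>Y. Y \<in> lie G \<Longrightarrow> hform e k (Y *v u) h = 0"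
    by (simp_all add: horizontal_iff[OF iso])
  have decomp: "\<exists>r q Z. Z \<in> lie G \<and> X *v u = rscale h r + rscale u q + Z *v u" if "X \<in> lie H" for X
  proof (rule vertical_decomposition[where L = "lie G" and u = u and h = h and X = X and e = e and k = k])
    show "subspace (lie G)"
      by (rule lie_subspace[OF GD(2-4)])
    show "(hform e k u v = 0 \<and> (\<forall>Y\<in>lie G. hform e k (Y *v u) v = 0)) \<longleftrightarrow> v \<in> range (rscale h)" for v
      by (simp only: hor[symmetric] horizontal_iff[OF iso])
  qed (use iso isoH comm mono mom h that in blast)+
  obtain r1 q1 Z1 where d1: "Z1 \<in> lie G" "X1 *v u = rscale h r1 + rscale u q1 + Z1 *v u"
    using decomp[OF X(1)] by blast
  obtain r2 q2 Z2 where d2: "Z2 \<in> lie G" "X2 *v u = rscale h r2 + rscale u q2 + Z2 *v u"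
    using decomp[OF X(2)] by blast
  have "K1 (\<pi> u) = D (X1 *v u)" "K2 (\<pi> u) = D (X2 *v u)"
    using K u D unfolding induced_field_def by blast+
  then have Kh: "K1 (\<pi> u) = D (rscale h r1)" "K2 (\<pi> u) = D (rscale h r2)"
    by (simp_all add: d1 d2 linear_add[OF linD] Dresc Dorb)
  have scale: "F ^ 4 * (x / \<bar>F\<bar> * (y / \<bar>F\<bar>) - (z / \<bar>F\<bar>)\<^sup>2) = F\<^sup>2 * (x * y - z\<^sup>2)"
    if "F \<noteq> 0" for F x y z :: real
  proof -
    have "x / \<bar>F\<bar> * (y / \<bar>F\<bar>) - (z / \<bar>F\<bar>)\<^sup>2 = (x * y - z\<^sup>2) / F\<^sup>2"
      by (simp add: power_divide diff_divide_distrib power2_eq_square)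
    then show ?thesis
      using that by (simp add: field_simps power2_eq_square power4_eq_xxxx)
  qed
  have "det (gram e k X1 X2 u) = (Fkl e k u u)\<^sup>2 *
      (Fkl e k (rscale h r1) (rscale h r1) * Fkl e k (rscale h r2) (rscale h r2)
        - (Fkl e k (rscale h r1) (rscale h r2))\<^sup>2)"
    by (rule det_momenta_eq_det_horizontal[OF orth(1) orth(2)[OF d1(1)] orth(2)[OF d2(1)]
          mom[OF d1(1)] mom[OF d2(1)] d1(2) d2(2)])
      (use hform_commuting_real isoH comm X d1 d2 mono in blast)+
  then show ?thesis
    unfolding Kh met[OF hor_in hor_in] scale[OF Fu] .
qed

text \<open>The derivative of the quotient map kills the directions \<open>Y u\<close> with \<open>Y\<close> in \<open>Lie G\<close>, so induced fields depend linearly on classes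
  modulo \<open>Lie G\<close>.\<close>

lemma induced_field_combination:
  fixes \<pi> :: "quat ^ 'm::finite \<Rightarrow> real ^ 4"
  assumes G: "abelian_subgroup G (Sp e k)" and Q: "semi_QK_quotient e k G P \<pi> M g"
    and K: "induced_field P \<pi> X1 K1" "induced_field P \<pi> X2 K2" "induced_field P \<pi> Y L"
    and Y: "Y - (a *\<^sub>R X1 + b *\<^sub>R X2) \<in> lie G" and u: "u \<in> P"
  shows "L (\<pi> u) = a *\<^sub>R K1 (\<pi> u) + b *\<^sub>R K2 (\<pi> u)"
proof -
  note GD = abelian_subgroupD[OF G]
  have N: "openin (top_of_set (zero_set e k G)) P"
    and fib: "\<forall>v\<in>P. path_component (P \<inter> line_orbit G u) u v \<longrightarrow> \<pi> u = \<pi> v"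
    and ext: "locally_extends_smoothly P \<pi>"
    using Q u unfolding semi_QK_quotient_def by blast+
  obtain D where D: "(\<pi> has_derivative D) (at u within P)"
    using ext u by (rule extension_has_derivative_within)
  have uN: "u \<in> zero_set e k G"
    using N u openin_imp_subset by blast
  have linD: "linear D"
    using D by (rule has_derivative_linear)
  have KD: "K1 (\<pi> u) = D (X1 *v u)" "K2 (\<pi> u) = D (X2 *v u)" "L (\<pi> u) = D (Y *v u)"
    using K u D unfolding induced_field_def by blast+
  define Z where "Z = Y - (a *\<^sub>R X1 + b *\<^sub>R X2)"
  have "D (Z *v u) = 0"
    by (rule derivative_vanishes_on_orbit[OF D fib N u _ Y[folded Z_def]])
      (rule zero_set_invariant[OF GD(1,4) _ uN])
  moreover have "Y *v u = Z *v u + (a *\<^sub>R (X1 *v u) + b *\<^sub>R (X2 *v u))"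
  proof -
    have "Y *v u = (Z + (a *\<^sub>R X1 + b *\<^sub>R X2)) *v u" by (simp add: Z_def)
    then show ?thesis
      by (simp only: matrix_vector_mult_add_rdistrib matrix_vector_scaleR(2))
  qed
  ultimately show ?thesis
    by (simp add: KD linear_add[OF linD] linear_scale[OF linD])
qed

section \<open>The torus part of the metric of an eigenfunction\<close>

text \<open>Symmetry and \<open>det B = 1\<close> express the remaining entry of \<open>B\<close> through \<open>\<rho>\<close> and \<open>\<eta>\<close>.\<close>

lemma half_space_of_hyperbolic:
  assumes "B \<in> hyperbolic_plane"
  shows "B $ 1 $ 1 > 0" "rho_of B > 0" "half_space (rho_of B) (eta_of B) = B"
proof -
  have "transpose B = B" "det B = 1" and pos: "\<And>v. v \<noteq> 0 \<Longrightarrow> 0 < v \<bullet> (B *v v)"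
    using assms by (auto simp: hyperbolic_plane_def)
  then have "transpose B $ 1 $ 2 = B $ 1 $ 2"
    by simp
  then have sym: "B $ 2 $ 1 = B $ 1 $ 2"
    by (simp add: transpose_def)
  then have det: "B $ 1 $ 1 * B $ 2 $ 2 = 1 + B $ 1 $ 2 * B $ 1 $ 2"
    using \<open>det B = 1\<close> by (simp add: det_2)
  show B11: "B $ 1 $ 1 > 0"
    using pos[of "axis 1 1"] by (simp add: inner_axis' matrix_vector_mul_component axis_eq_0_iff)
      (simp add: inner_axis)
  then show "rho_of B > 0"
    by (simp add: rho_of_def)
  have "((1 / B $ 1 $ 1)\<^sup>2 + (B $ 1 $ 2 / B $ 1 $ 1)\<^sup>2) * B $ 1 $ 1 = (1 + B $ 1 $ 2 * B $ 1 $ 2) / B $ 1 $ 1"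
    using B11 by (simp add: field_simps power2_eq_square)
  also have "\<dots> = B $ 2 $ 2"
    using B11 unfolding det[symmetric] by simp
  finally show "half_space (rho_of B) (eta_of B) = B"
    using B11 by (simp add: half_space_def rho_of_def eta_of_def vec_eq_iff forall_2 vector_2 sym)
qed

text \<open>The left-hand side is four times the Gram determinant of \<open>\<partial>\<^sub>\<phi>, \<partial>\<^sub>\<psi>\<close>, expressed through the
  quadratic form alone. The matrix \<open>(a, b; b, d)\<close> below, acting on the unimodular coframe
  \<open>\<alpha>, \<beta>\<close>, has determinant \<open>discr\<close>.\<close>

lemma gF_torus_determinant:
  assumes "\<rho> > 0" "coord F \<rho> \<eta> \<noteq> 0" "discr F \<rho> \<eta> \<noteq> 0"
  shows "4 * gF F \<rho> \<eta> 0 0 1 0 * gF F \<rho> \<eta> 0 0 0 1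
    - (gF F \<rho> \<eta> 0 0 1 1 - gF F \<rho> \<eta> 0 0 1 0 - gF F \<rho> \<eta> 0 0 0 1)\<^sup>2 = 4 / coord F \<rho> \<eta> ^ 4"
proof -
  define f where "f = coord F \<rho> \<eta>"
  define \<Delta> where "\<Delta> = discr F \<rho> \<eta>"
  define a where "a = f - 2 * \<rho> * d_rho (coord F) \<rho> \<eta>"
  define b where "b = - 2 * \<rho> * d_eta (coord F) \<rho> \<eta>"
  define d where "d = f + 2 * \<rho> * d_rho (coord F) \<rho> \<eta>"
  have \<Delta>: "a * d - b\<^sup>2 = \<Delta>"
    by (simp add: a_def b_def d_def \<Delta>_def discr_def f_def power2_eq_square algebra_simps)
  define \<alpha> \<beta> \<gamma> where "\<alpha> = sqrt \<rho>" and "\<beta> = \<eta> / sqrt \<rho>" and "\<gamma> = 1 / sqrt \<rho>"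
  have \<alpha>\<gamma>: "\<alpha> * \<gamma> = 1"
    using assms(1) by (simp add: \<alpha>_def \<gamma>_def)
  define v1 v2 w1 w2 where "v1 = a * \<alpha> + b * \<beta>" and "v2 = b * \<alpha> + d * \<beta>" and "w1 = b * \<gamma>" and "w2 = d * \<gamma>"
  define q where "q p s = (v1 * p + w1 * s)\<^sup>2 + (v2 * p + w2 * s)\<^sup>2" for p s
  have gF: "gF F \<rho> \<eta> 0 0 p s = q p s / (f\<^sup>2 * \<Delta>)" for p s
  proof -
    have "(s + \<eta> * p) / sqrt \<rho> = \<gamma> * s + \<beta> * p"
      by (simp add: \<beta>_def \<gamma>_def add_divide_distrib)
    then have "gF F \<rho> \<eta> 0 0 p s = ((a * (\<alpha> * p) + b * (\<gamma> * s + \<beta> * p))\<^sup>2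
        + (b * (\<alpha> * p) + d * (\<gamma> * s + \<beta> * p))\<^sup>2) / (f\<^sup>2 * \<Delta>)"
      by (simp add: gF_def Let_def a_def b_def d_def f_def \<Delta>_def \<alpha>_def)
    then show ?thesis
      by (simp add: q_def v1_def v2_def w1_def w2_def algebra_simps)
  qed
  have "v1 * w2 - v2 * w1 = (a * d - b\<^sup>2) * (\<alpha> * \<gamma>)"
    by (simp add: v1_def v2_def w1_def w2_def power2_eq_square algebra_simps)
  then have "v1 * w2 - v2 * w1 = \<Delta>"
    by (simp add: \<Delta> \<alpha>\<gamma>)
  moreover have "4 * q 1 0 * q 0 1 - (q 1 1 - q 1 0 - q 0 1)\<^sup>2 = 4 * (v1 * w2 - v2 * w1)\<^sup>2"
    by (simp add: q_def power2_eq_square algebra_simps)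
  ultimately have q: "4 * q 1 0 * q 0 1 - (q 1 1 - q 1 0 - q 0 1)\<^sup>2 = 4 * \<Delta>\<^sup>2"
    by simp
  have "4 * (q 1 0 / x) * (q 0 1 / x) - (q 1 1 / x - q 1 0 / x - q 0 1 / x)\<^sup>2
      = (4 * q 1 0 * q 0 1 - (q 1 1 - q 1 0 - q 0 1)\<^sup>2) / x\<^sup>2" for x
    by (simp add: power_divide diff_divide_distrib[symmetric]) (simp add: power2_eq_square diff_divide_distrib)
  then show ?thesis
    using assms(2,3) unfolding gF q
    by (simp add: power_mult_distrib f_def[symmetric] \<Delta>_def[symmetric])
qed

lemma torus_coordinates_differentiable:
  assumes "torus_coordinates U \<rho> \<eta> \<phi> \<psi> L1 L2" "y \<in> U"
  shows "\<rho> differentiable (at y)" "\<eta> differentiable (at y)" "\<phi> differentiable (at y)" "\<psi> differentiable (at y)"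
proof -
  have "smooth_on U (\<lambda>y. (\<rho> y, \<eta> y, \<phi> y, \<psi> y))"
    using assms(1) by (simp add: torus_coordinates_def)
  then obtain f' where f': "((\<lambda>y. (\<rho> y, \<eta> y, \<phi> y, \<psi> y)) has_derivative f') (at y)"
    using assms(2) by (rule smooth_on_has_derivative)
  note d = has_derivative_fst[OF f'] has_derivative_snd[OF f']
  note d' = has_derivative_fst[OF d(2)] has_derivative_snd[OF d(2)]
  note d'' = has_derivative_fst[OF d'(2)] has_derivative_snd[OF d'(2)]
  show "\<rho> differentiable (at y)" "\<eta> differentiable (at y)" "\<phi> differentiable (at y)" "\<psi> differentiable (at y)"
    using d d' d'' unfolding differentiable_def by auto
qed

lemma torus_gram_of_gF:
  fixes L1 L2 :: "real ^ 4 \<Rightarrow> real ^ 4"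
  assumes T: "torus_coordinates U \<rho> \<eta> \<phi> \<psi> L1 L2" "y \<in> U"
    and "transpose (g y) = g y" and "\<rho> y > 0"
    and "coord F (\<rho> y) (\<eta> y) \<noteq> 0" "discr F (\<rho> y) (\<eta> y) \<noteq> 0"
    and metric: "\<And>\<xi>. \<xi> \<bullet> (g y *v \<xi>) = c * gF F (\<rho> y) (\<eta> y) (frechet_derivative \<rho> (at y) \<xi>)
        (frechet_derivative \<eta> (at y) \<xi>) (frechet_derivative \<phi> (at y) \<xi>) (frechet_derivative \<psi> (at y) \<xi>)"
  shows "(L1 y \<bullet> (g y *v L1 y)) * (L2 y \<bullet> (g y *v L2 y)) - (L1 y \<bullet> (g y *v L2 y))\<^sup>2
    = c\<^sup>2 / coord F (\<rho> y) (\<eta> y) ^ 4"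
proof -
  note lin = torus_coordinates_differentiable[OF T, THEN frechet_derivative_works[THEN iffD1], THEN has_derivative_linear, THEN linear_add]
  have d: "frechet_derivative \<rho> (at y) (L1 y) = 0" "frechet_derivative \<eta> (at y) (L1 y) = 0"
     "frechet_derivative \<phi> (at y) (L1 y) = 1" "frechet_derivative \<psi> (at y) (L1 y) = 0"
     "frechet_derivative \<rho> (at y) (L2 y) = 0" "frechet_derivative \<eta> (at y) (L2 y) = 0"
     "frechet_derivative \<phi> (at y) (L2 y) = 0" "frechet_derivative \<psi> (at y) (L2 y) = 1"
    using T by (simp_all add: torus_coordinates_def Let_def)
  let ?q = "gF F (\<rho> y) (\<eta> y) 0 0"
  have Q: "L1 y \<bullet> (g y *v L1 y) = c * ?q 1 0" "L2 y \<bullet> (g y *v L2 y) = c * ?q 0 1"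
    "(L1 y + L2 y) \<bullet> (g y *v (L1 y + L2 y)) = c * ?q 1 1"
    unfolding metric by (simp_all add: lin d)
  have "L2 y \<bullet> (g y *v L1 y) = L1 y \<bullet> (g y *v L2 y)"
    by (metis assms(3) dot_lmul_matrix inner_commute transpose_matrix_vector)
  then have off: "2 * (L1 y \<bullet> (g y *v L2 y)) = c * (?q 1 1 - ?q 1 0 - ?q 0 1)"
    using Q by (simp add: matrix_vector_right_distrib inner_add_left inner_add_right right_diff_distrib)
  have "4 * ((L1 y \<bullet> (g y *v L1 y)) * (L2 y \<bullet> (g y *v L2 y)) - (L1 y \<bullet> (g y *v L2 y))\<^sup>2)
      = 4 * (c * ?q 1 0) * (c * ?q 0 1) - (c * (?q 1 1 - ?q 1 0 - ?q 0 1))\<^sup>2"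
    unfolding Q(1,2) off[symmetric] by (simp add: power2_eq_square)
  also have "\<dots> = c\<^sup>2 * (4 * ?q 1 0 * ?q 0 1 - (?q 1 1 - ?q 1 0 - ?q 0 1)\<^sup>2)"
    by (simp add: power_mult_distrib power2_eq_square algebra_simps)
  finally have "4 * ((L1 y \<bullet> (g y *v L1 y)) * (L2 y \<bullet> (g y *v L2 y)) - (L1 y \<bullet> (g y *v L2 y))\<^sup>2)
      = 4 * (c\<^sup>2 / coord F (\<rho> y) (\<eta> y) ^ 4)"
    unfolding gF_torus_determinant[OF assms(4-6)] by simp
  then show ?thesis
    by (rule mult_left_cancel[of 4, THEN iffD1, OF zero_neq_numeral[symmetric]])
qed

lemma gram_determinant_change_of_basis:
  fixes v1 v2 :: "real ^ 4"
  assumes sym: "transpose B = B" and w: "w1 = a *\<^sub>R v1 + b *\<^sub>R v2" "w2 = c *\<^sub>R v1 + d *\<^sub>R v2"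
  shows "(w1 \<bullet> (B *v w1)) * (w2 \<bullet> (B *v w2)) - (w1 \<bullet> (B *v w2))\<^sup>2
    = (a * d - b * c)\<^sup>2 * ((v1 \<bullet> (B *v v1)) * (v2 \<bullet> (B *v v2)) - (v1 \<bullet> (B *v v2))\<^sup>2)"
proof -
  have s: "v2 \<bullet> (B *v v1) = v1 \<bullet> (B *v v2)"
    by (metis sym dot_lmul_matrix inner_commute transpose_matrix_vector)
  show ?thesis
    unfolding w
    by (simp add: matrix_vector_right_distrib inner_add_left inner_add_right matrix_vector_mult_scaleR s)
      algebra
qed

lemma coord_hyperbolic: "B \<in> hyperbolic_plane \<Longrightarrow> coord F (rho_of B) (eta_of B) = F B"
  by (simp add: coord_def half_space_of_hyperbolic)

text \<open>The regularity of \<open>F\<close> is a condition in half-space coordinates, hence the detour through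
  them.\<close>

lemma eigenfunction_continuous_along:
  fixes \<Phi> :: "real ^ 4 \<Rightarrow> real ^ 2 ^ 2"
  assumes F: "hyperbolic_eigenfunction \<Omega> F" and im: "\<Phi> ` M \<subseteq> \<Omega>" and cont: "continuous_on M \<Phi>"
  shows "continuous_on M (\<lambda>y. F (\<Phi> y))"
proof -
  let ?S = "{p. 0 < fst p \<and> half_space (fst p) (snd p) \<in> \<Omega>}"
  have "Ck_on 2 ?S (\<lambda>p. coord F (fst p) (snd p))" and \<Omega>: "\<Omega> \<subseteq> hyperbolic_plane"
    using F openin_imp_subset by (auto simp: hyperbolic_eigenfunction_def)
  then obtain f' where "\<forall>p\<in>?S. ((\<lambda>p. coord F (fst p) (snd p)) has_derivative f' p) (at p)"
    unfolding numeral_2_eq_2 Ck_on.simps by blast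
  then have F_cont: "continuous_on ?S (\<lambda>p. coord F (fst p) (snd p))"
    by (intro continuous_at_imp_continuous_on ballI has_derivative_continuous) (rule bspec)
  have hyp: "\<Phi> y \<in> hyperbolic_plane" if "y \<in> M" for y
    using that im \<Omega> by blast
  have "continuous_on M (\<lambda>y. (rho_of (\<Phi> y), eta_of (\<Phi> y)))"
    unfolding rho_of_def eta_of_def
    by (intro continuous_intros cont ballI order.strict_implies_not_eq[symmetric] half_space_of_hyperbolic(1) hyp)
  then have "continuous_on M (\<lambda>y. coord F (rho_of (\<Phi> y)) (eta_of (\<Phi> y)))"
    using continuous_on_compose2[OF F_cont, of M "\<lambda>y. (rho_of (\<Phi> y), eta_of (\<Phi> y))"]
      half_space_of_hyperbolic(2,3)[OF hyp] im by (simp add: image_subset_iff)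
  then show ?thesis
    using hyp by (simp add: coord_hyperbolic cong: continuous_on_cong)
qed

text \<open>Intermediate values: a change of sign would produce a zero.\<close>

lemma nonvanishing_on_connected_sgn:
  fixes f :: "'a::topological_space \<Rightarrow> real"
  assumes "connected M" "continuous_on M f" "\<And>x. x \<in> M \<Longrightarrow> f x \<noteq> 0" "x \<in> M" "y \<in> M"
  shows "sgn (f x) = sgn (f y)"
proof (rule ccontr)
  assume "sgn (f x) \<noteq> sgn (f y)"
  then have "0 \<in> {f x..f y} \<or> 0 \<in> {f y..f x}"
    by (auto simp: sgn_if split: if_splits)
  moreover have "connected (f ` M)"
    using assms by (intro connected_continuous_image)
  ultimately have "0 \<in> f ` M"
    using connected_contains_Icc assms(4,5) by blast
  then show False
    using assms(3) by fastforce
qed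

section \<open>Comparison of the two determinants\<close>

text \<open>The equation makes \<open>A\<close> positive and determines \<open>\<bar>f\<bar>\<close> times its fourth root; the signs
  convert absolute values back to \<open>f\<close> and \<open>q\<close>.\<close>

lemma fourth_root_solution:
  fixes A f q c m :: real
  assumes eq: "A * f ^ 4 * m\<^sup>2 = c\<^sup>2 * q ^ 4" and nz: "f \<noteq> 0" "c \<noteq> 0" "q \<noteq> 0"
  shows "A powr (1 / 4) * f = sgn f * sgn q * root 4 (c\<^sup>2 / m\<^sup>2) * q" and "m \<noteq> 0"
proof -
  show "m \<noteq> 0"
    using eq nz by auto
  then have A: "A = c\<^sup>2 / m\<^sup>2 * \<bar>q / f\<bar> ^ 4" and "c\<^sup>2 / m\<^sup>2 > 0"
    using eq nz by (simp_all add: field_simps power_divide)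
  then have "A > 0"
    using \<open>c\<^sup>2 / m\<^sup>2 > 0\<close> nz unfolding A by (intro mult_pos_pos zero_less_power) simp_all
  then have "A powr (1 / 4) = root 4 A"
    using root_powr_inverse[of 4 A] by simp
  also have "\<dots> = root 4 (c\<^sup>2 / m\<^sup>2) * \<bar>q / f\<bar>"
    unfolding A real_root_mult by (simp add: real_root_power_cancel)
  finally show "A powr (1 / 4) * f = sgn f * sgn q * root 4 (c\<^sup>2 / m\<^sup>2) * q"
    using nz by (simp add: sgn_if)
qed

theorem theorem8p1:
  fixes n k l :: nat
    and e :: "'m::finite \<Rightarrow> nat"
    and G H :: "(quat ^ 'm ^ 'm) set"
    and X1 X2 :: "quat ^ 'm ^ 'm"
    and P :: "(quat ^ 'm) set"
    and \<pi> :: "quat ^ 'm \<Rightarrow> real ^ 4"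
    and M :: "(real ^ 4) set"
    and g :: metric4
    and K1 K2 :: "real ^ 4 \<Rightarrow> real ^ 4"
    and \<Phi> :: "real ^ 4 \<Rightarrow> real ^ 2 ^ 2"
    and \<Omega> :: "(real ^ 2 ^ 2) set"
    and F :: "real ^ 2 ^ 2 \<Rightarrow> real"
  assumes "k + l = n + 1" and "bij_betw e UNIV {..n}"
    and "abelian_subgroup G (Sp e k)" and "dim (lie G) + 1 = n"
    and "maximal_abelian_subgroup H (Sp e k)" and "G \<subseteq> H" and "dim (lie H) = n + 1"
    and "projects_to_basis X1 X2 (lie G) (lie H)"
    and "semi_QK_quotient e k G P \<pi> M g"
    and "self_dual M g" and "einstein M g"
    and "induced_field P \<pi> X1 K1" and "induced_field P \<pi> X2 K2"
    and "killing_field M g K1" and "killing_field M g K2" and "commuting_fields M K1 K2"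
    and "\<forall>x\<in>M. lin_indep2 (K1 x) (K2 x)"
    and "\<forall>u\<in>P. lin_indep2 (momentum e k X1 u) (momentum e k X2 u)"
    and "smooth_on M \<Phi>" and "\<forall>u\<in>P. \<Phi> (\<pi> u) = normalized (gram e k X1 X2 u)"
    and "generates G H P \<pi> M g \<Phi> \<Omega> F"
  shows "\<exists>c. c \<noteq> 0 \<and> (\<forall>u\<in>P. half_lift F (gram e k X1 X2 u) = c * Fkl e k u u)"
proof -
  note G = \<open>abelian_subgroup G (Sp e k)\<close> and Q = \<open>semi_QK_quotient e k G P \<pi> M g\<close>
  note K = \<open>induced_field P \<pi> X1 K1\<close> \<open>induced_field P \<pi> X2 K2\<close>
  have H: "abelian_subgroup H (Sp e k)"
    using \<open>maximal_abelian_subgroup H (Sp e k)\<close> by (simp add: maximal_abelian_subgroup_def)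
  have X: "X1 \<in> lie H" "X2 \<in> lie H"
    using \<open>projects_to_basis X1 X2 (lie G) (lie H)\<close> by (simp_all add: projects_to_basis_def)
  have M: "connected M" "\<pi> ` P = M" "\<And>y. y \<in> M \<Longrightarrow> transpose (g y) = g y"
    and sign: "(\<forall>u\<in>P. Fkl e k u u < 0) \<or> (\<forall>u\<in>P. 0 < Fkl e k u u)"
    using Q unfolding semi_QK_quotient_def definite_metric_def by blast+
  have F: "hyperbolic_eigenfunction \<Omega> F" "\<Phi> ` M \<subseteq> \<Omega>"
    using \<open>generates G H P \<pi> M g \<Phi> \<Omega> F\<close> by (simp_all add: generates_def)
  have hyp: "\<Phi> y \<in> hyperbolic_plane" if "y \<in> M" for y
    using F that openin_imp_subset unfolding hyperbolic_eigenfunction_def by blast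
  obtain c Y1 Y2 L1 L2 where c: "c \<noteq> 0" and Y: "projects_to_basis Y1 Y2 (lie G) (lie H)"
    and L: "induced_field P \<pi> Y1 L1" "induced_field P \<pi> Y2 L2"
    and chart: "\<forall>x\<in>M. \<exists>U \<phi> \<psi>. open U \<and> x \<in> U \<and> U \<subseteq> M \<and>
        torus_coordinates U (\<lambda>y. rho_of (\<Phi> y)) (\<lambda>y. eta_of (\<Phi> y)) \<phi> \<psi> L1 L2 \<and>
        (\<forall>y\<in>U. F (\<Phi> y) \<noteq> 0 \<and> discr F (rho_of (\<Phi> y)) (eta_of (\<Phi> y)) \<noteq> 0 \<and>
          (\<forall>\<xi>. \<xi> \<bullet> (g y *v \<xi>) = c * gF F (rho_of (\<Phi> y)) (eta_of (\<Phi> y))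
            (frechet_derivative (\<lambda>y. rho_of (\<Phi> y)) (at y) \<xi>) (frechet_derivative (\<lambda>y. eta_of (\<Phi> y)) (at y) \<xi>)
            (frechet_derivative \<phi> (at y) \<xi>) (frechet_derivative \<psi> (at y) \<xi>)))"
    using \<open>generates G H P \<pi> M g \<Phi> \<Omega> F\<close> unfolding generates_def Let_def by blast
  have F_nz: "F (\<Phi> y) \<noteq> 0" if "y \<in> M" for y
    using chart that by blast
  have L_det: "(L1 y \<bullet> (g y *v L1 y)) * (L2 y \<bullet> (g y *v L2 y)) - (L1 y \<bullet> (g y *v L2 y))\<^sup>2
      = c\<^sup>2 / F (\<Phi> y) ^ 4" if y: "y \<in> M" for y
  proof -
    obtain U \<phi> \<psi> where U: "y \<in> U"
        "torus_coordinates U (\<lambda>y. rho_of (\<Phi> y)) (\<lambda>y. eta_of (\<Phi> y)) \<phi> \<psi> L1 L2"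
        "discr F (rho_of (\<Phi> y)) (eta_of (\<Phi> y)) \<noteq> 0"
        "\<And>\<xi>. \<xi> \<bullet> (g y *v \<xi>) = c * gF F (rho_of (\<Phi> y)) (eta_of (\<Phi> y))
            (frechet_derivative (\<lambda>y. rho_of (\<Phi> y)) (at y) \<xi>) (frechet_derivative (\<lambda>y. eta_of (\<Phi> y)) (at y) \<xi>)
            (frechet_derivative \<phi> (at y) \<xi>) (frechet_derivative \<psi> (at y) \<xi>)"
      using bspec[OF chart y]
      by (elim exE conjE) (drule (1) bspec, elim conjE, rule that; (assumption | erule spec))
    have F_coord: "coord F (rho_of (\<Phi> y)) (eta_of (\<Phi> y)) = F (\<Phi> y)"
      using hyp[OF y] by (rule coord_hyperbolic)
    then have "coord F (rho_of (\<Phi> y)) (eta_of (\<Phi> y)) \<noteq> 0"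
      using F_nz[OF y] by simp
    note torus_gram_of_gF[where \<rho> = "\<lambda>y. rho_of (\<Phi> y)" and \<eta> = "\<lambda>y. eta_of (\<Phi> y)" and g = g and y = y,
        OF U(2,1) M(3)[OF y] half_space_of_hyperbolic(2)[OF hyp[OF y]] this U(3,4)]
    then show ?thesis
      unfolding F_coord .
  qed
  have "Y1 \<in> lie H" "Y2 \<in> lie H"
    using Y by (simp_all add: projects_to_basis_def)
  then obtain a1 b1 a2 b2 where ab: "Y1 - (a1 *\<^sub>R X1 + b1 *\<^sub>R X2) \<in> lie G" "Y2 - (a2 *\<^sub>R X1 + b2 *\<^sub>R X2) \<in> lie G"
    using \<open>projects_to_basis X1 X2 (lie G) (lie H)\<close> unfolding projects_to_basis_def by blast
  \<comment> \<open>The change of basis between \<open>X\<^sub>1, X\<^sub>2\<close> and \<open>Y\<^sub>1, Y\<^sub>2\<close> modulo \<open>Lie G\<close> has constant coefficients,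
    so it contributes only the constant \<open>m\<^sup>2\<close>.\<close>
  define m where "m = a1 * b2 - b1 * a2"
  have key: "det (gram e k X1 X2 u) * F (\<Phi> (\<pi> u)) ^ 4 * m\<^sup>2 = c\<^sup>2 * Fkl e k u u ^ 4" if u: "u \<in> P" for u
  proof -
    have y: "\<pi> u \<in> M" using M u by blast
    let ?K = "(K1 (\<pi> u) \<bullet> (g (\<pi> u) *v K1 (\<pi> u))) * (K2 (\<pi> u) \<bullet> (g (\<pi> u) *v K2 (\<pi> u)))
      - (K1 (\<pi> u) \<bullet> (g (\<pi> u) *v K2 (\<pi> u)))\<^sup>2"
    have "m\<^sup>2 * ?K = c\<^sup>2 / F (\<Phi> (\<pi> u)) ^ 4"
      unfolding m_def L_det[OF y, symmetric]
      by (rule gram_determinant_change_of_basis[OF M(3)[OF y], symmetric])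
        (rule induced_field_combination[OF G Q K L(1) ab(1) u] induced_field_combination[OF G Q K L(2) ab(2) u])+
    then have "c\<^sup>2 = m\<^sup>2 * ?K * F (\<Phi> (\<pi> u)) ^ 4"
      using F_nz[OF y] by simp
    then show ?thesis
      unfolding quotient_gram_determinant[OF G H \<open>G \<subseteq> H\<close> X Q K u] by (simp only: mult_ac)
  qed
  have Fkl_nz: "Fkl e k u u \<noteq> 0" if "u \<in> P" for u
    using sign that by force
  have cont: "continuous_on M (\<lambda>y. F (\<Phi> y))"
  proof (rule eigenfunction_continuous_along[OF F])
    show "continuous_on M \<Phi>"
      using \<open>smooth_on M \<Phi>\<close> unfolding smooth_on_def by (metis Ck_on.simps(1))
  qed
  show ?thesis
  proof (cases "P = {}")
    case True
    then show ?thesis by (auto intro: exI[of _ 1])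
  next
    case False
    then obtain u0 where u0: "u0 \<in> P" by blast
    define \<kappa> where "\<kappa> = sgn (F (\<Phi> (\<pi> u0))) * sgn (Fkl e k u0 u0) * root 4 (c\<^sup>2 / m\<^sup>2)"
    have \<pi>: "\<pi> u \<in> M" if "u \<in> P" for u
      using M that by blast
    have "m \<noteq> 0"
      by (rule fourth_root_solution(2)[OF key[OF u0] F_nz[OF \<pi>[OF u0]] c Fkl_nz[OF u0]])
    then have "\<kappa> \<noteq> 0"
      using c F_nz \<pi> Fkl_nz u0 by (simp add: \<kappa>_def sgn_zero_iff)
    moreover have "half_lift F (gram e k X1 X2 u) = \<kappa> * Fkl e k u u" if u: "u \<in> P" for u
    proof -
      have "half_lift F (gram e k X1 X2 u) = det (gram e k X1 X2 u) powr (1 / 4) * F (\<Phi> (\<pi> u))"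
        using \<open>\<forall>u\<in>P. \<Phi> (\<pi> u) = normalized (gram e k X1 X2 u)\<close> u by (simp add: half_lift_def)
      also have "\<dots> = sgn (F (\<Phi> (\<pi> u))) * sgn (Fkl e k u u) * root 4 (c\<^sup>2 / m\<^sup>2) * Fkl e k u u"
        by (rule fourth_root_solution(1)[OF key[OF u] F_nz[OF \<pi>[OF u]] c Fkl_nz[OF u]])
      also have "sgn (F (\<Phi> (\<pi> u))) = sgn (F (\<Phi> (\<pi> u0)))"
        by (rule nonvanishing_on_connected_sgn[OF M(1) cont F_nz \<pi>[OF u] \<pi>[OF u0]])
      also have "sgn (Fkl e k u u) = sgn (Fkl e k u0 u0)"
        using sign u u0 by (auto simp: sgn_if)
      finally show ?thesis by (simp add: \<kappa>_def)
    qed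
    ultimately show ?thesis by blast
  qed
qed

end
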